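(* Let $(O,C,E)$, $(O',C',E')$, $(O'',C'',E'')$ be local M-polyfold models and let $f:O\to O'$ and $g:O'\to O''$ be $\mathrm{sc}^1$-maps between local M-polyfold models. Then the composition $g\circ f:O\to O''$ is an $\mathrm{sc}^1$-map and $$T(g\circ f)=Tg\circ Tf.$$
   Context: An sc-structure on a Banach space $E$ is a nested sequence $E=E_0\supset E_1\supset\cdots$ of Banach spaces such that every inclusion $E_{m+1}\to E_m$ is compact and $E_\infty:=\bigcap_m E_m$ is dense in every $E_m$; $E$ is then an sc-Banach space. $|\cdot|_m$ is the norm of $E_m$. $E\oplus F$ has levels $E_m\oplus F_m$; $E^k$ is $E_k$ with levels $(E^k)_m=E_{k+m}$. A linear map $T:E\to F$ is an sc-operator if it maps $E_m$ continuously into $F_m$ for all $m$; a linear sc-isomorphism is a bijective sc-operator whose inverse is an sc-operator. A partial quadrant in $E$ is a closed subset $C\subset E$ for which there are an sc-Banach space $W$, an integer $k\ge0$ and a linear sc-isomorphism $T:E\to\mathbb R^k\oplus W$ with $T(C)=[0,\infty)^k\oplus W$; for $x\in C$ with $T(x)=(r_1,\dots,r_k,w)$ put $d_C(x)=\#\{i: r_i=0\}$ (independent of $T$). A relatively open $U\subset C$ has levels $U_m=U\cap E_m$; $U^k$ is $U_k$ with levels $U_{k+m}$; $TU=U^1\oplus E$. A map $f:U\to V$ between relatively open subsets of partial quadrants in $E$, $F$ is $\mathrm{sc}^0$ if $f(U_m)\subset V_m$ and $f:U_m\to V_m$ is continuous for all $m$. An $\mathrm{sc}^0$-map is $\mathrm{sc}^1$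 if for every $x\in U_1$ there is a bounded linear operator $Df(x):E_0\to F_0$ such that (1) $\lim_{|h|_1\to0}\frac1{|h|_1}|f(x+h)-f(x)-Df(x)h|_0=0$ for $h\in E_1$, $x+h\in C$; (2) $Tf:TU\to TV$, $(x,h)\mapsto(f(x),Df(x)h)$, is $\mathrm{sc}^0$. Inductively $f$ is $\mathrm{sc}^{k+1}$ if it is $\mathrm{sc}^1$ and $Tf$ is $\mathrm{sc}^k$; sc-smooth means $\mathrm{sc}^k$ for all $k$. An sc-smooth retraction is an sc-smooth map $r:U\to U$, $U$ relatively open in a partial quadrant $C$, with $r\circ r=r$. A local M-polyfold model is a triple $(O,C,E)$ with $E$ an sc-Banach space, $C\subset E$ a partial quadrant and $O\subset C$ such that: (1) $O=r(U)$ for some sc-smooth retraction $r:U\to U$, $U\subset C$ relatively open; (2) for every smooth point $x\in O_\infty=O\cap E_\infty$ the kernel of $\mathrm{id}-Dr(x)$ has an sc-complement contained in $C$; (3) for every $x\in O$ there is a sequence $(x_k)\subset O_\infty$ converging to $x$ in $O$ with $d_C(x_k)=d_C(x)$. Its tangent is $TO:=Tr(TU)$, which does not depend on the choice of the sc-smooth retraction $r$ onto $O$. A map $f:(O,C,E)\to(O',C',E')$ (i.e. $f:O\to O'$) is $\mathrm{sc}^k$ if $f\circ r:U\to E'$ is $\mathrm{sc}^k$ for an (equivalently any) sc-smooth retraction $r:U\to U$ with $r(U)=O$, $U\subset C$ relatively open; if $f$ is $\mathrm{sc}^1$, its tangent map is $Tf:=T(f\circ r)|_{TO}:TO\to TO'$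 (independent of $r$). *)

theory Defs
  imports "HOL-Analysis.Analysis" "HOL-Analysis.Finite_Function_Topology"
begin

section \<open>Sc-Banach spaces\<close>

text \<open>
  A scale of normed spaces inside an ambient real vector space. The ambient type carries only
  the algebra. Not even the level 0 has to be the whole type, so that the shifted space
  \<open>E\<^sup>k\<close> and sc-subspaces live on the same type.
\<close>

record 'a sc_space =
  level :: "nat \<Rightarrow> 'a set"
  lnorm :: "nat \<Rightarrow> 'a \<Rightarrow> real"

definition norm_on :: "'a::real_vector set \<Rightarrow> ('a \<Rightarrow> real) \<Rightarrow> bool" where
  "norm_on S n \<longleftrightarrow> subspace S \<and>
     (\<forall>x\<in>S. 0 \<le> n x \<and> (n x = 0 \<longleftrightarrow> x = 0)) \<and>
     (\<forall>x\<in>S. \<forall>y\<in>S. n (x + y) \<le> n x + n y) \<and>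
     (\<forall>c. \<forall>x\<in>S. n (c *\<^sub>R x) = \<bar>c\<bar> * n x)"

text \<open>\<^locale>\<open>Metric_space\<close> wants distances to be nonnegative and symmetric on the whole type;
  \<open>lnorm E m\<close> is arbitrary off \<open>level E m\<close>, hence the guard.\<close>

definition ldist :: "'a::real_vector sc_space \<Rightarrow> nat \<Rightarrow> 'a \<Rightarrow> 'a \<Rightarrow> real" where
  "ldist E m x y = (if x \<in> level E m \<and> y \<in> level E m then lnorm E m (x - y) else 0)"

definition level_top :: "'a::real_vector sc_space \<Rightarrow> nat \<Rightarrow> 'a topology" where
  "level_top E m = Metric_space.mtopology (level E m) (ldist E m)"

definition smooth_points :: "'a sc_space \<Rightarrow> 'a set" where
  "smooth_points E = (\<Inter>m. level E m)"

definition sc_banach :: "'a::real_vector sc_space \<Rightarrow> bool" where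
  "sc_banach E \<longleftrightarrow> (\<forall>m.
     norm_on (level E m) (lnorm E m) \<and>
     Metric_space.mcomplete (level E m) (ldist E m) \<and>
     level E (Suc m) \<subseteq> level E m \<and>
     compactin (level_top E m)
       (level_top E m closure_of {x \<in> level E (Suc m). lnorm E (Suc m) x \<le> 1}) \<and>
     level_top E m closure_of smooth_points E = level E m)"

definition sc_sum :: "'a sc_space \<Rightarrow> 'b sc_space \<Rightarrow> ('a \<times> 'b) sc_space" where
  "sc_sum E F = \<lparr> level = \<lambda>m. level E m \<times> level F m,
                  lnorm = \<lambda>m (x, y). lnorm E m x + lnorm F m y \<rparr>"

definition sc_shift :: "nat \<Rightarrow> 'a sc_space \<Rightarrow> 'a sc_space" where
  "sc_shift k E = \<lparr> level = \<lambda>m. level E (k + m), lnorm = \<lambda>m. lnorm E (k + m) \<rparr>"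

definition linear_between ::
  "'a::real_vector set \<Rightarrow> 'b::real_vector set \<Rightarrow> ('a \<Rightarrow> 'b) \<Rightarrow> bool" where
  "linear_between S T f \<longleftrightarrow> f ` S \<subseteq> T \<and>
     (\<forall>x\<in>S. \<forall>y\<in>S. f (x + y) = f x + f y) \<and> (\<forall>c. \<forall>x\<in>S. f (c *\<^sub>R x) = c *\<^sub>R f x)"

definition sc_operator ::
  "'a::real_vector sc_space \<Rightarrow> 'b::real_vector sc_space \<Rightarrow> ('a \<Rightarrow> 'b) \<Rightarrow> bool" where
  "sc_operator E F T \<longleftrightarrow> linear_between (level E 0) (level F 0) T \<and>
     (\<forall>m. continuous_map (level_top E m) (level_top F m) T)"

definition sc_iso ::
  "'a::real_vector sc_space \<Rightarrow> 'b::real_vector sc_space \<Rightarrow> ('a \<Rightarrow> 'b) \<Rightarrow> bool" where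
  "sc_iso E F T \<longleftrightarrow> sc_operator E F T \<and> bij_betw T (level E 0) (level F 0) \<and>
     sc_operator F E (inv_into (level E 0) T)"

type_synonym 'a fin_seq = "nat \<Rightarrow>\<^sub>0 'a"

section \<open>Partial quadrants\<close>

text \<open>\<open>\<real>\<^sup>k\<close> with the constant sc-structure, as the finitely supported real sequences
  that vanish from index \<open>k\<close> on.\<close>

definition sc_Rk :: "nat \<Rightarrow> real fin_seq sc_space" where
  "sc_Rk k = \<lparr> level = \<lambda>m. {r. Poly_Mapping.keys r \<subseteq> {..<k}}, lnorm = \<lambda>m. norm \<rparr>"

text \<open>The sc-Banach space \<open>W\<close> may be taken on the ambient type of \<open>E\<close> without loss
  of generality: \<open>T\<close> identifies \<open>W\<close> with the subspace \<open>T\<inverse>(0 \<oplus> W)\<close> of \<open>E\<close>.\<close>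

definition quadrant_chart ::
  "'a::real_vector sc_space \<Rightarrow> 'a set \<Rightarrow> nat \<Rightarrow> 'a sc_space \<Rightarrow>
     ('a \<Rightarrow> real fin_seq \<times> 'a) \<Rightarrow> bool" where
  "quadrant_chart E C k W T \<longleftrightarrow> sc_banach W \<and> sc_iso E (sc_sum (sc_Rk k) W) T \<and>
     T ` C = {(r, w). r \<in> level (sc_Rk k) 0 \<and> (\<forall>i<k. 0 \<le> Poly_Mapping.lookup r i) \<and> w \<in> level W 0}"

definition partial_quadrant :: "'a::real_vector sc_space \<Rightarrow> 'a set \<Rightarrow> bool" where
  "partial_quadrant E C \<longleftrightarrow>
     closedin (level_top E 0) C \<and> (\<exists>k W T. quadrant_chart E C k W T)"

definition degeneracy :: "'a::real_vector sc_space \<Rightarrow> 'a set \<Rightarrow> 'a \<Rightarrow> nat" where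
  "degeneracy E C x = (THE n. \<exists>k W T. quadrant_chart E C k W T \<and>
     n = card {i. i < k \<and> Poly_Mapping.lookup (fst (T x)) i = 0})"

section \<open>Sc-differentiability\<close>

definition sc0 :: "'a::real_vector sc_space \<Rightarrow> 'a set \<Rightarrow> 'b::real_vector sc_space \<Rightarrow> 'b set \<Rightarrow>
    ('a \<Rightarrow> 'b) \<Rightarrow> bool" where
  "sc0 E U F V f \<longleftrightarrow>
     (\<forall>m. continuous_map (subtopology (level_top E m) U) (subtopology (level_top F m) V) f)"

text \<open>
  \<open>L\<close> is the sc-derivative of \<open>f : U \<rightarrow> F\<close> at \<open>x \<in> U\<^sub>1\<close>. As \<open>f\<close> is given on \<open>U\<close> only, the
  limit runs over \<open>x + h \<in> U\<close>; for \<open>U\<close> relatively open in a partial quadrant \<open>C\<close> this is the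
  limit over \<open>x + h \<in> C\<close>, since then \<open>x + h \<in> U\<close> as soon as \<open>\<bar>h\<bar>\<^sub>1\<close> is small.
\<close>

definition has_sc_derivative :: "'a::real_vector sc_space \<Rightarrow> 'a set \<Rightarrow> 'b::real_vector sc_space \<Rightarrow>
    ('a \<Rightarrow> 'b) \<Rightarrow> 'a \<Rightarrow> ('a \<Rightarrow> 'b) \<Rightarrow> bool" where
  "has_sc_derivative E U F f x L \<longleftrightarrow>
     linear_between (level E 0) (level F 0) L \<and>
     (\<exists>B. \<forall>h\<in>level E 0. lnorm F 0 (L h) \<le> B * lnorm E 0 h) \<and>
     ((\<lambda>h. lnorm F 0 (f (x + h) - f x - L h) / lnorm E 1 h) \<longlongrightarrow> 0)
        (atin_within (level_top E 1) 0 {h. x + h \<in> U})"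

definition T_space :: "'a sc_space \<Rightarrow> ('a \<times> 'a) sc_space" where
  "T_space E = sc_sum (sc_shift 1 E) E"

definition T_set :: "'a sc_space \<Rightarrow> 'a set \<Rightarrow> ('a \<times> 'a) set" where
  "T_set E U = (U \<inter> level E 1) \<times> level E 0"

definition T_with :: "('a \<Rightarrow> 'b) \<Rightarrow> ('a \<Rightarrow> 'a \<Rightarrow> 'b) \<Rightarrow> 'a \<times> 'a \<Rightarrow> 'b \<times> 'b" where
  "T_with f D = (\<lambda>(x, h). (f x, D x h))"

definition sc1 :: "'a::real_vector sc_space \<Rightarrow> 'a set \<Rightarrow> 'b::real_vector sc_space \<Rightarrow> 'b set \<Rightarrow>
    ('a \<Rightarrow> 'b) \<Rightarrow> bool" where
  "sc1 E U F V f \<longleftrightarrow> sc0 E U F V f \<and>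
     (\<exists>D. (\<forall>x \<in> U \<inter> level E 1. has_sc_derivative E U F f x (D x)) \<and>
          sc0 (T_space E) (T_set E U) (T_space F) (T_set F V) (T_with f D))"

text \<open>
  For \<open>U\<close> relatively open in a partial quadrant the derivative is unique on \<open>E\<^sub>0\<close>: the
  admissible directions \<open>h\<close> span the dense subspace \<open>E\<^sub>1\<close>.
\<close>

definition sc_D :: "'a::real_vector sc_space \<Rightarrow> 'a set \<Rightarrow> 'b::real_vector sc_space \<Rightarrow>
    ('a \<Rightarrow> 'b) \<Rightarrow> 'a \<Rightarrow> 'a \<Rightarrow> 'b" where
  "sc_D E U F f x = (SOME L. has_sc_derivative E U F f x L)"

definition T_map :: "'a::real_vector sc_space \<Rightarrow> 'a set \<Rightarrow> 'b::real_vector sc_space \<Rightarrow>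
    ('a \<Rightarrow> 'b) \<Rightarrow> 'a \<times> 'a \<Rightarrow> 'b \<times> 'b" where
  "T_map E U F f = T_with f (sc_D E U F f)"

subsection \<open>Higher order\<close>

text \<open>
  The recursion ``\<open>f\<close> is \<open>sc\<^sup>k\<^sup>+\<^sup>1\<close> iff it is \<open>sc\<^sup>1\<close> and \<open>Tf\<close> is \<open>sc\<^sup>k\<close>'' passes from the type
  \<open>'a\<close> to \<open>'a \<times> 'a\<close>, which a recursive definition in HOL cannot do. It is therefore carried out
  on the type of finitely supported sequences in \<open>'a\<close>: \<open>'a\<close> embeds as the sequences supported
  at 0, and a pair of sequences is coded by the sequence with these even and odd parts. The lemmas
  \<open>sc_k_0\<close>, \<open>sc_k_1\<close> and \<open>sc_k_Suc\<close> at the end of this theory show that the resulting \<open>sc_k\<close>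
  satisfies the uncoded recursion. In the step, \<open>sc\<^sup>0\<close> of \<open>Tf\<close> is not listed separately, as it
  is part of \<open>sc\<^sup>k\<close>.
\<close>

definition sc_image :: "('a \<Rightarrow> 'b) \<Rightarrow> ('b \<Rightarrow> 'a) \<Rightarrow> 'a sc_space \<Rightarrow> 'b sc_space" where
  "sc_image c d E = \<lparr> level = \<lambda>m. c ` level E m, lnorm = \<lambda>m u. lnorm E m (d u) \<rparr>"

definition unweave :: "'a::zero fin_seq \<Rightarrow> 'a fin_seq \<times> 'a fin_seq" where
  "unweave u = (Poly_Mapping.map_key (\<lambda>n. 2 * n) u, Poly_Mapping.map_key (\<lambda>n. 2 * n + 1) u)"

definition weave :: "'a::zero fin_seq \<times> 'a fin_seq \<Rightarrow> 'a fin_seq" where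
  "weave = the_inv unweave"

primrec sc_k_coded :: "nat \<Rightarrow> 'a::real_vector fin_seq sc_space \<Rightarrow> 'a fin_seq set \<Rightarrow>
    'b::real_vector fin_seq sc_space \<Rightarrow> 'b fin_seq set \<Rightarrow>
    ('a fin_seq \<Rightarrow> 'b fin_seq) \<Rightarrow> bool" where
  "sc_k_coded 0 E U F V f \<longleftrightarrow> sc0 E U F V f"
| "sc_k_coded (Suc k) E U F V f \<longleftrightarrow> sc0 E U F V f \<and>
     (\<exists>D. (\<forall>x \<in> U \<inter> level E 1. has_sc_derivative E U F f x (D x)) \<and>
          sc_k_coded k (sc_image weave unweave (T_space E)) (weave ` T_set E U)
            (sc_image weave unweave (T_space F)) (weave ` T_set F V)
            (weave \<circ> T_with f D \<circ> unweave))"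

abbreviation "code0 \<equiv> Poly_Mapping.single (0::nat)"

abbreviation "decode0 u \<equiv> Poly_Mapping.lookup u (0::nat)"

definition sc_k :: "nat \<Rightarrow> 'a::real_vector sc_space \<Rightarrow> 'a set \<Rightarrow> 'b::real_vector sc_space \<Rightarrow>
    'b set \<Rightarrow> ('a \<Rightarrow> 'b) \<Rightarrow> bool" where
  "sc_k k E U F V f \<longleftrightarrow>
     sc_k_coded k (sc_image code0 decode0 E) (code0 ` U) (sc_image code0 decode0 F) (code0 ` V)
       (code0 \<circ> f \<circ> decode0)"

definition sc_smooth :: "'a::real_vector sc_space \<Rightarrow> 'a set \<Rightarrow> 'b::real_vector sc_space \<Rightarrow>
    'b set \<Rightarrow> ('a \<Rightarrow> 'b) \<Rightarrow> bool" where
  "sc_smooth E U F V f \<longleftrightarrow> (\<forall>k. sc_k k E U F V f)"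

section \<open>Local M-polyfold models\<close>

definition sc_retraction :: "'a::real_vector sc_space \<Rightarrow> 'a set \<Rightarrow> 'a set \<Rightarrow> ('a \<Rightarrow> 'a) \<Rightarrow> bool" where
  "sc_retraction E C U r \<longleftrightarrow> openin (subtopology (level_top E 0) C) U \<and>
     sc_smooth E U E U r \<and> (\<forall>x\<in>U. r (r x) = r x)"

definition sc_subspace :: "'a::real_vector sc_space \<Rightarrow> 'a set \<Rightarrow> bool" where
  "sc_subspace E K \<longleftrightarrow> closedin (level_top E 0) K \<and>
     sc_banach \<lparr> level = \<lambda>m. K \<inter> level E m, lnorm = lnorm E \<rparr>"

definition sc_complement :: "'a::real_vector sc_space \<Rightarrow> 'a set \<Rightarrow> 'a set \<Rightarrow> bool" where
  "sc_complement E K G \<longleftrightarrow> sc_subspace E K \<and> sc_subspace E G \<and> K \<inter> G = {0} \<and>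
     (\<forall>m. level E m = {x + y | x y. x \<in> K \<inter> level E m \<and> y \<in> G \<inter> level E m})"

definition polyfold_model :: "'a set \<Rightarrow> 'a set \<Rightarrow> 'a::real_vector sc_space \<Rightarrow> bool" where
  "polyfold_model X C E \<longleftrightarrow> sc_banach E \<and> partial_quadrant E C \<and> X \<subseteq> C \<and>
     (\<exists>U r. sc_retraction E C U r \<and> r ` U = X \<and>
        (\<forall>x \<in> X \<inter> smooth_points E.
           \<exists>G. sc_complement E {h \<in> level E 0. h - sc_D E U E r x h = 0} G \<and> G \<subseteq> C)) \<and>
     (\<forall>x\<in>X. \<exists>\<xi>. (\<forall>k. \<xi> k \<in> X \<inter> smooth_points E \<and> degeneracy E C (\<xi> k) = degeneracy E C x) \<and>
        limitin (subtopology (level_top E 0) X) \<xi> x sequentially)"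

text \<open>
  A choice of domain \<open>U\<close> and sc-smooth retraction \<open>r : U \<rightarrow> U\<close> onto \<open>X\<close>. The tangent \<open>TX\<close> and
  the tangent maps below do not depend on it.
\<close>

definition retraction_onto :: "'a set \<Rightarrow> 'a set \<Rightarrow> 'a::real_vector sc_space \<Rightarrow>
    'a set \<times> ('a \<Rightarrow> 'a)" where
  "retraction_onto X C E = (SOME (U, r). sc_retraction E C U r \<and> r ` U = X)"

definition model_T :: "'a set \<Rightarrow> 'a set \<Rightarrow> 'a::real_vector sc_space \<Rightarrow> ('a \<times> 'a) set" where
  "model_T X C E = (let (U, r) = retraction_onto X C E in T_map E U E r ` T_set E U)"

definition model_sc1 :: "'a set \<Rightarrow> 'a set \<Rightarrow> 'a::real_vector sc_space \<Rightarrow>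
    'b set \<Rightarrow> 'b set \<Rightarrow> 'b::real_vector sc_space \<Rightarrow> ('a \<Rightarrow> 'b) \<Rightarrow> bool" where
  "model_sc1 X C E X' C' E' f \<longleftrightarrow> f ` X \<subseteq> X' \<and>
     (\<exists>U r. sc_retraction E C U r \<and> r ` U = X \<and> sc1 E U E' (level E' 0) (f \<circ> r))"

definition model_T_map :: "'a set \<Rightarrow> 'a set \<Rightarrow> 'a::real_vector sc_space \<Rightarrow>
    'b::real_vector sc_space \<Rightarrow> ('a \<Rightarrow> 'b) \<Rightarrow> 'a \<times> 'a \<Rightarrow> 'b \<times> 'b" where
  "model_T_map X C E E' f = (let (U, r) = retraction_onto X C E in
     restrict (T_map E U E' (f \<circ> r)) (model_T X C E))"

section \<open>The coded recursion agrees with the uncoded one\<close>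

definition normed_scale :: "'a::real_vector sc_space \<Rightarrow> bool" where
  "normed_scale E \<longleftrightarrow> (\<forall>m. norm_on (level E m) (lnorm E m) \<and> level E (Suc m) \<subseteq> level E m)"

lemma sc_banach_normed_scale: "sc_banach E \<Longrightarrow> normed_scale E"
  by (simp add: sc_banach_def normed_scale_def)

lemma level_antimono: "normed_scale E \<Longrightarrow> m \<le> n \<Longrightarrow> level E n \<subseteq> level E m"
  by (rule lift_Suc_antimono_le[of "level E"]) (auto simp: normed_scale_def)

lemma level_0: "normed_scale E \<Longrightarrow> x \<in> level E m \<Longrightarrow> x \<in> level E 0"
  using level_antimono by blast

lemma norm_on_level: "normed_scale E \<Longrightarrow> norm_on (level E m) (lnorm E m)"
  by (simp add: normed_scale_def)

lemma level_subspace: "normed_scale E \<Longrightarrow> subspace (level E m)"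
  by (simp add: normed_scale_def norm_on_def)

lemma Metric_space_level:
  assumes "normed_scale E" shows "Metric_space (level E m) (ldist E m)"
proof -
  define S N where SN: "S = level E m" "N = lnorm E m"
  have n: "norm_on S N" and sub: "subspace S"
    using assms by (auto simp: normed_scale_def norm_on_def SN)
  have neg: "N (y - x) = N (x - y)" if "x \<in> S" "y \<in> S" for x y
  proof -
    have "N ((-1) *\<^sub>R (x - y)) = \<bar>-1\<bar> * N (x - y)"
      using n that sub by (metis norm_on_def subspace_diff)
    then show ?thesis by simp
  qed
  have "Metric_space S (\<lambda>x y. if x \<in> S \<and> y \<in> S then N (x - y) else 0)"
  proof
    fix x y z
    show "0 \<le> (if x \<in> S \<and> y \<in> S then N (x - y) else 0)"
      using n sub by (auto simp: norm_on_def subspace_diff)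
    show "(if x \<in> S \<and> y \<in> S then N (x - y) else 0) = (if y \<in> S \<and> x \<in> S then N (y - x) else 0)"
      using neg by auto
    assume x: "x \<in> S" and y: "y \<in> S"
    show "((if x \<in> S \<and> y \<in> S then N (x - y) else 0) = 0) = (x = y)"
      using n x y sub by (simp add: norm_on_def subspace_diff)
    assume z: "z \<in> S"
    have "N ((x - y) + (y - z)) \<le> N (x - y) + N (y - z)"
      using n x y z by (metis norm_on_def subspace_diff)
    then show "(if x \<in> S \<and> z \<in> S then N (x - z) else 0)
      \<le> (if x \<in> S \<and> y \<in> S then N (x - y) else 0) + (if y \<in> S \<and> z \<in> S then N (y - z) else 0)"
      using x y z by simp
  qed
  moreover have "ldist E m = (\<lambda>x y. if x \<in> S \<and> y \<in> S then N (x - y) else 0)"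
    by (auto simp: ldist_def SN fun_eq_iff)
  ultimately show ?thesis by (simp add: SN)
qed

lemma topspace_level_top [simp]: "normed_scale E \<Longrightarrow> topspace (level_top E m) = level E m"
  by (simp add: level_top_def Metric_space.topspace_mtopology Metric_space_level)

lemma sc0_iff:
  assumes E: "normed_scale E" and F: "normed_scale F"
  shows "sc0 E U F V f \<longleftrightarrow> (\<forall>m. \<forall>x \<in> U \<inter> level E m. f x \<in> V \<inter> level F m \<and>
    (\<forall>\<epsilon>>0. \<exists>\<delta>>0. \<forall>y \<in> U \<inter> level E m. lnorm E m (x - y) < \<delta> \<longrightarrow> lnorm F m (f x - f y) < \<epsilon>))"
proof -
  have "continuous_map (subtopology (level_top E m) U) (subtopology (level_top F m) V) f \<longleftrightarrow>
    (\<forall>x \<in> U \<inter> level E m. f x \<in> V \<inter> level F m \<and>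
    (\<forall>\<epsilon>>0. \<exists>\<delta>>0. \<forall>y \<in> U \<inter> level E m. lnorm E m (x - y) < \<delta> \<longrightarrow> lnorm F m (f x - f y) < \<epsilon>))" for m
  proof -
    define S where "S = U \<inter> level E m"
    interpret S: Submetric "level E m" "ldist E m" S
      using Metric_space_level[OF E] by (auto simp: S_def Submetric_def Submetric_axioms_def)
    have top: "subtopology (level_top E m) U = S.sub.mtopology"
      using E S.mtopology_submetric
      by (metis S_def Int_commute level_top_def subtopology_restrict topspace_level_top)
    have ts: "topspace S.sub.mtopology = S" by simp
    have c1: "continuous_map (subtopology (level_top E m) U) (subtopology (level_top F m) V) f \<longleftrightarrow>
       continuous_map S.sub.mtopology (Metric_space.mtopology (level F m) (ldist F m)) f \<and> f \<in> S \<rightarrow> V"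
      by (simp only: continuous_map_in_subtopology top ts) (simp only: level_top_def)
    have c2: "continuous_map S.sub.mtopology (Metric_space.mtopology (level F m) (ldist F m)) f \<longleftrightarrow>
       f ` S \<subseteq> level F m \<and>
       (\<forall>a\<in>S. \<forall>\<epsilon>>0. \<exists>\<delta>>0. \<forall>x. x \<in> S \<and> ldist E m a x < \<delta> \<longrightarrow> ldist F m (f a) (f x) < \<epsilon>)"
      by (rule S.sub.metric_continuous_map[OF Metric_space_level[OF F]])
    have c3: "(\<forall>a\<in>S. \<forall>\<epsilon>>0. \<exists>\<delta>>0. \<forall>x. x \<in> S \<and> ldist E m a x < \<delta> \<longrightarrow> ldist F m (f a) (f x) < \<epsilon>) \<longleftrightarrow>
       (\<forall>a\<in>S. \<forall>\<epsilon>>0. \<exists>\<delta>>0. \<forall>x\<in>S. lnorm E m (a - x) < \<delta> \<longrightarrow> lnorm F m (f a - f x) < \<epsilon>)"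
      if f: "f ` S \<subseteq> level F m"
    proof -
      have "(\<forall>x. x \<in> S \<and> ldist E m a x < \<delta> \<longrightarrow> ldist F m (f a) (f x) < \<epsilon>) \<longleftrightarrow>
          (\<forall>x\<in>S. lnorm E m (a - x) < \<delta> \<longrightarrow> lnorm F m (f a - f x) < \<epsilon>)" if a: "a \<in> S" for a \<delta> \<epsilon>
      proof -
        have "ldist E m a x = lnorm E m (a - x)" "ldist F m (f a) (f x) = lnorm F m (f a - f x)" if "x \<in> S" for x
          using that a f by (auto simp: ldist_def S_def)
        then show ?thesis by auto
      qed
      then show ?thesis by simp
    qed
    have "(f ` S \<subseteq> level F m \<and> P) \<and> f \<in> S \<rightarrow> V \<longleftrightarrow> (\<forall>x\<in>S. f x \<in> V \<inter> level F m) \<and> P" for P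
      by auto
    with c1 c2 c3 show ?thesis
      unfolding ball_conj_distrib S_def[symmetric] by blast
  qed
  then show ?thesis by (simp add: sc0_def)
qed

lemma has_sc_derivative_iff:
  assumes E: "normed_scale E"
  shows "has_sc_derivative E U F f x L \<longleftrightarrow>
     linear_between (level E 0) (level F 0) L \<and>
     (\<exists>B. \<forall>h\<in>level E 0. lnorm F 0 (L h) \<le> B * lnorm E 0 h) \<and>
     (\<forall>\<epsilon>>0. \<exists>\<delta>>0. \<forall>h \<in> level E 1. x + h \<in> U \<and> 0 < lnorm E 1 h \<and> lnorm E 1 h < \<delta> \<longrightarrow>
        \<bar>lnorm F 0 (f (x + h) - f x - L h) / lnorm E 1 h\<bar> < \<epsilon>)"
proof -
  have 0: "0 \<in> level E 1" using level_subspace[OF E] by (rule subspace_0)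
  have "eventually P (atin_within (level_top E 1) 0 {h. x + h \<in> U}) \<longleftrightarrow>
    (\<exists>\<delta>>0. \<forall>h \<in> level E 1. x + h \<in> U \<and> 0 < lnorm E 1 h \<and> lnorm E 1 h < \<delta> \<longrightarrow> P h)" for P
    unfolding level_top_def Metric_space.eventually_atin_within_metric[OF Metric_space_level[OF E]]
    using 0 by (auto simp: ldist_def)
  then show ?thesis
    unfolding has_sc_derivative_def tendsto_iff by simp
qed

definition scale_iso :: "'a::real_vector sc_space \<Rightarrow> 'b::real_vector sc_space \<Rightarrow> ('a \<Rightarrow> 'b) \<Rightarrow> bool" where
  "scale_iso E F \<phi> \<longleftrightarrow> normed_scale E \<and> normed_scale F \<and>
     linear_between (level E 0) (level F 0) \<phi> \<and> inj_on \<phi> (level E 0) \<and>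
     (\<forall>m. \<phi> ` level E m = level F m \<and> (\<forall>x\<in>level E m. lnorm F m (\<phi> x) = lnorm E m x))"

lemma linear_between_diff:
  assumes "linear_between S T f" "subspace S" "x \<in> S" "y \<in> S"
  shows "f (x - y) = f x - f y"
proof -
  have "f (x + (-1) *\<^sub>R y) = f x + f ((-1) *\<^sub>R y)"
    using assms by (metis linear_between_def subspace_scale)
  also have "f ((-1) *\<^sub>R y) = (-1) *\<^sub>R f y"
    using assms unfolding linear_between_def by blast
  finally show ?thesis by simp
qed

lemma scale_iso_diff:
  "scale_iso E F \<phi> \<Longrightarrow> x \<in> level E 0 \<Longrightarrow> y \<in> level E 0 \<Longrightarrow> \<phi> (x - y) = \<phi> x - \<phi> y"
  using level_subspace by (fastforce simp: scale_iso_def intro: linear_between_diff)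

lemma scale_iso_norm_diff:
  assumes "scale_iso E F \<phi>" "x \<in> level E m" "y \<in> level E m"
  shows "lnorm F m (\<phi> x - \<phi> y) = lnorm E m (x - y)"
proof -
  have E: "normed_scale E" using assms by (simp add: scale_iso_def)
  have "\<phi> x - \<phi> y = \<phi> (x - y)"
    using scale_iso_diff[OF assms(1)] level_0[OF E] assms(2,3) by simp
  moreover have "x - y \<in> level E m" using level_subspace[OF E] assms(2,3) by (rule subspace_diff)
  ultimately show ?thesis using assms(1) by (simp add: scale_iso_def)
qed

lemma scale_iso_inv:
  assumes "scale_iso E F \<phi>" shows "scale_iso F E (inv_into (level E 0) \<phi>)"
proof -
  let ?\<psi> = "inv_into (level E 0) \<phi>"
  have E: "normed_scale E" and inj: "inj_on \<phi> (level E 0)" and lin: "linear_between (level E 0) (level F 0) \<phi>"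
    and im: "\<And>m. \<phi> ` level E m = level F m" using assms by (auto simp: scale_iso_def)
  have l: "?\<psi> (\<phi> x) = x" if "x \<in> level E 0" for x using inj that by simp
  have sub: "subspace (level E 0)" using E by (rule level_subspace)
  have "linear_between (level F 0) (level E 0) ?\<psi>"
    unfolding linear_between_def im[of 0, symmetric]
  proof (intro conjI ballI allI)
    show "?\<psi> ` \<phi> ` level E 0 \<subseteq> level E 0" using l by auto
  next
    fix u v assume "u \<in> \<phi> ` level E 0" "v \<in> \<phi> ` level E 0"
    then obtain x y where xy: "x \<in> level E 0" "y \<in> level E 0" "u = \<phi> x" "v = \<phi> y" by auto
    then have "u + v = \<phi> (x + y)" using lin by (simp add: linear_between_def)
    then show "?\<psi> (u + v) = ?\<psi> u + ?\<psi> v" using xy l sub by (simp add: subspace_add)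
  next
    fix c u assume "u \<in> \<phi> ` level E 0"
    then obtain x where x: "x \<in> level E 0" "u = \<phi> x" by auto
    then have "c *\<^sub>R u = \<phi> (c *\<^sub>R x)" using lin by (simp add: linear_between_def)
    then show "?\<psi> (c *\<^sub>R u) = c *\<^sub>R ?\<psi> u" using x l sub by (simp add: subspace_scale)
  qed
  moreover have "inj_on ?\<psi> (level F 0)" unfolding im[of 0, symmetric] using l by (auto simp: inj_on_def)
  moreover have "?\<psi> ` level F m = level E m \<and> (\<forall>y\<in>level F m. lnorm E m (?\<psi> y) = lnorm F m y)" for m
  proof -
    have "lnorm F m (\<phi> x) = lnorm E m x" if "x \<in> level E m" for x
      using assms that by (auto simp: scale_iso_def)
    moreover have "?\<psi> ` \<phi> ` level E m = level E m"
      unfolding image_image using l level_0[OF E] by force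
    ultimately show ?thesis unfolding im[of m, symmetric] using l level_0[OF E] by auto
  qed
  ultimately show ?thesis using assms by (simp add: scale_iso_def)
qed

lemma scale_iso_comp:
  assumes \<phi>: "scale_iso E F \<phi>" and \<psi>: "scale_iso F G \<psi>" shows "scale_iso E G (\<psi> \<circ> \<phi>)"
proof -
  have im: "\<And>m. \<phi> ` level E m = level F m" "\<And>m. \<psi> ` level F m = level G m"
    using assms by (auto simp: scale_iso_def)
  then have mem: "\<And>m x. x \<in> level E m \<Longrightarrow> \<phi> x \<in> level F m" "\<And>m x. x \<in> level F m \<Longrightarrow> \<psi> x \<in> level G m"
    by blast+
  have "linear_between (level E 0) (level G 0) (\<psi> \<circ> \<phi>)"
    using assms mem by (simp add: scale_iso_def linear_between_def image_subset_iff)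
  moreover have "inj_on (\<psi> \<circ> \<phi>) (level E 0)"
    using assms im(1)[of 0] by (intro comp_inj_on) (simp_all add: scale_iso_def)
  moreover have "(\<psi> \<circ> \<phi>) ` level E m = level G m" for m
    using im by (metis image_comp)
  moreover have "lnorm G m ((\<psi> \<circ> \<phi>) x) = lnorm E m x" if "x \<in> level E m" for m x
    using assms mem that by (simp add: scale_iso_def)
  ultimately show ?thesis using assms by (simp add: scale_iso_def)
qed

lemma sc0_transport:
  assumes \<phi>: "scale_iso E E' \<phi>" and \<psi>: "scale_iso F F' \<psi>" and U: "U \<subseteq> level E 0" and V: "V \<subseteq> level F 0"
    and f0': "\<forall>x\<in>U. f' (\<phi> x) = \<psi> (f x)" and f: "sc0 E U F V f"
  shows "sc0 E' (\<phi> ` U) F' (\<psi> ` V) f'"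
proof -
  note f' = bspec[OF f0']
  have n: "normed_scale E" "normed_scale E'" "normed_scale F" "normed_scale F'"
    using \<phi> \<psi> by (auto simp: scale_iso_def)
  have lev: "\<phi> ` U \<inter> level E' m = \<phi> ` (U \<inter> level E m)" for m
  proof -
    have "\<phi> ` (U \<inter> level E m) = \<phi> ` U \<inter> \<phi> ` level E m"
      using \<phi> U level_antimono[OF n(1)] unfolding scale_iso_def
      by (intro inj_on_image_Int[of \<phi> "level E 0"]) auto
    then show ?thesis using \<phi> by (simp add: scale_iso_def)
  qed
  have f: "f x \<in> V \<inter> level F m \<and> (\<forall>\<epsilon>>0. \<exists>\<delta>>0. \<forall>y \<in> U \<inter> level E m. lnorm E m (x - y) < \<delta> \<longrightarrow> lnorm F m (f x - f y) < \<epsilon>)"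
    if "x \<in> U \<inter> level E m" for m x
    using f that unfolding sc0_iff[OF n(1) n(3)] by blast
  show ?thesis unfolding sc0_iff[OF n(2) n(4)] lev
  proof (intro allI ballI conjI impI)
    fix m u assume "u \<in> \<phi> ` (U \<inter> level E m)"
    then obtain x where x: "x \<in> U \<inter> level E m" "u = \<phi> x" by auto
    have fx: "f x \<in> V \<inter> level F m" using f x by blast
    show "f' u \<in> \<psi> ` V \<inter> level F' m"
      using fx x f' \<psi> unfolding scale_iso_def by auto
    fix \<epsilon>::real assume "\<epsilon> > 0"
    then obtain \<delta> where "\<delta> > 0" and d: "\<And>y. y \<in> U \<inter> level E m \<Longrightarrow> lnorm E m (x - y) < \<delta> \<Longrightarrow> lnorm F m (f x - f y) < \<epsilon>"
      using f x by blast
    have "lnorm F' m (f' u - f' v) < \<epsilon>" if v: "v \<in> \<phi> ` (U \<inter> level E m)" and l: "lnorm E' m (u - v) < \<delta>" for v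
    proof -
      obtain y where y: "y \<in> U \<inter> level E m" "v = \<phi> y" using v by auto
      have "lnorm E m (x - y) < \<delta>" using scale_iso_norm_diff[OF \<phi>] x y l by simp
      then have "lnorm F m (f x - f y) < \<epsilon>" using d y by blast
      moreover have "f y \<in> level F m" using f[OF y(1)] by blast
      ultimately show ?thesis using scale_iso_norm_diff[OF \<psi>] x y f' fx by simp
    qed
    then show "\<exists>\<delta>>0. \<forall>v\<in>\<phi> ` (U \<inter> level E m). lnorm E' m (u - v) < \<delta> \<longrightarrow> lnorm F' m (f' u - f' v) < \<epsilon>"
      using \<open>\<delta> > 0\<close> by blast
  qed
qed

lemma has_sc_derivative_transport:
  assumes \<phi>: "scale_iso E E' \<phi>" and \<psi>: "scale_iso F F' \<psi>" and U: "U \<subseteq> level E 0"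
    and fU: "f ` U \<subseteq> level F 0" and f0': "\<forall>x\<in>U. f' (\<phi> x) = \<psi> (f x)"
    and L': "\<And>h. h \<in> level E 0 \<Longrightarrow> L' (\<phi> h) = \<psi> (L h)"
    and x: "x \<in> U \<inter> level E 1" and f: "has_sc_derivative E U F f x L"
  shows "has_sc_derivative E' (\<phi> ` U) F' f' (\<phi> x) L'"
proof -
  note f' = bspec[OF f0']
  have n: "normed_scale E" "normed_scale E'" "normed_scale F" "normed_scale F'"
    and im: "\<And>m. level E' m = \<phi> ` level E m" and inj: "inj_on \<phi> (level E 0)"
    and lin: "linear_between (level E 0) (level E' 0) \<phi>" "linear_between (level F 0) (level F' 0) \<psi>"
    and n\<phi>: "\<And>m h. h \<in> level E m \<Longrightarrow> lnorm E' m (\<phi> h) = lnorm E m h"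
    and n\<psi>: "\<And>m h. h \<in> level F m \<Longrightarrow> lnorm F' m (\<psi> h) = lnorm F m h"
    using \<phi> \<psi> by (auto simp: scale_iso_def)
  have sE: "subspace (level E 0)" and sF: "subspace (level F 0)" using n by (auto intro: level_subspace)
  have linL: "linear_between (level E 0) (level F 0) L"
    and bd: "\<exists>B. \<forall>h\<in>level E 0. lnorm F 0 (L h) \<le> B * lnorm E 0 h"
    and lim: "\<And>\<epsilon>. \<epsilon>>0 \<Longrightarrow> \<exists>\<delta>>0. \<forall>h \<in> level E 1. x + h \<in> U \<and> 0 < lnorm E 1 h \<and> lnorm E 1 h < \<delta> \<longrightarrow>
        \<bar>lnorm F 0 (f (x + h) - f x - L h) / lnorm E 1 h\<bar> < \<epsilon>"
    using f unfolding has_sc_derivative_iff[OF n(1)] by blast+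
  have L: "L h \<in> level F 0" if "h \<in> level E 0" for h using linL that by (auto simp: linear_between_def)
  have "linear_between (level E' 0) (level F' 0) L'"
    unfolding linear_between_def im
  proof (intro conjI ballI allI)
    show "L' ` \<phi> ` level E 0 \<subseteq> level F' 0" using L' L lin(2) by (auto simp: linear_between_def)
  next
    fix u v assume "u \<in> \<phi> ` level E 0" "v \<in> \<phi> ` level E 0"
    then obtain a b where ab: "a \<in> level E 0" "b \<in> level E 0" "u = \<phi> a" "v = \<phi> b" by auto
    then have "u + v = \<phi> (a + b)" using lin by (simp add: linear_between_def)
    then have "L' (u + v) = \<psi> (L (a + b))" using L' ab sE by (simp add: subspace_add)
    also have "\<dots> = \<psi> (L a) + \<psi> (L b)" using linL lin(2) ab L by (simp add: linear_between_def)
    finally show "L' (u + v) = L' u + L' v" using L' ab by simp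
  next
    fix c u assume "u \<in> \<phi> ` level E 0"
    then obtain a where a: "a \<in> level E 0" "u = \<phi> a" by auto
    then have "c *\<^sub>R u = \<phi> (c *\<^sub>R a)" using lin by (simp add: linear_between_def)
    then have "L' (c *\<^sub>R u) = \<psi> (L (c *\<^sub>R a))" using L' a sE by (simp add: subspace_scale)
    also have "\<dots> = c *\<^sub>R \<psi> (L a)" using linL lin(2) a L by (simp add: linear_between_def)
    finally show "L' (c *\<^sub>R u) = c *\<^sub>R L' u" using L' a by simp
  qed
  moreover have "\<exists>B. \<forall>h\<in>level E' 0. lnorm F' 0 (L' h) \<le> B * lnorm E' 0 h"
    using bd unfolding im by (auto simp: L' n\<phi> n\<psi> L)
  moreover have "\<exists>\<delta>>0. \<forall>h \<in> level E' 1. \<phi> x + h \<in> \<phi> ` U \<and> 0 < lnorm E' 1 h \<and> lnorm E' 1 h < \<delta> \<longrightarrow>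
        \<bar>lnorm F' 0 (f' (\<phi> x + h) - f' (\<phi> x) - L' h) / lnorm E' 1 h\<bar> < \<epsilon>" if "\<epsilon> > 0" for \<epsilon>
  proof -
    obtain \<delta> where "\<delta> > 0" and d: "\<And>h. h \<in> level E 1 \<Longrightarrow> x + h \<in> U \<Longrightarrow> 0 < lnorm E 1 h \<Longrightarrow> lnorm E 1 h < \<delta> \<Longrightarrow>
        \<bar>lnorm F 0 (f (x + h) - f x - L h) / lnorm E 1 h\<bar> < \<epsilon>" using lim[OF \<open>\<epsilon> > 0\<close>] by blast
    have "\<bar>lnorm F' 0 (f' (\<phi> x + h) - f' (\<phi> x) - L' h) / lnorm E' 1 h\<bar> < \<epsilon>"
      if h: "h \<in> level E' 1" "\<phi> x + h \<in> \<phi> ` U" "0 < lnorm E' 1 h" "lnorm E' 1 h < \<delta>" for h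
    proof -
      obtain a where a: "a \<in> level E 1" "h = \<phi> a" using h im by auto
      have a0: "a \<in> level E 0" using a level_0 n by blast
      have x0: "x \<in> level E 0" using x U by blast
      have eq: "\<phi> x + h = \<phi> (x + a)" using lin(1) a x0 a0 by (simp add: linear_between_def)
      have xa: "x + a \<in> U"
      proof -
        obtain y where y: "y \<in> U" "\<phi> (x + a) = \<phi> y" using h eq by auto
        have "x + a \<in> level E 0" "y \<in> level E 0" using x0 a0 sE U y by (auto intro: subspace_add)
        then have "x + a = y" using inj_onD[OF inj y(2)] by blast
        then show ?thesis using y by simp
      qed
      have m: "f (x + a) \<in> level F 0" "f x \<in> level F 0" "L a \<in> level F 0" using fU xa x L a0 by auto
      have dm: "f (x + a) - f x \<in> level F 0" using m sF by (simp add: subspace_diff)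
      have "f' (\<phi> x + h) - f' (\<phi> x) - L' h = \<psi> (f (x + a)) - \<psi> (f x) - \<psi> (L a)"
        unfolding eq using f'[OF xa] f'[of x] x L'[OF a0] a(2) by simp
      also have "\<dots> = \<psi> (f (x + a) - f x - L a)"
        by (simp only: scale_iso_diff[OF \<psi> m(1,2)] scale_iso_diff[OF \<psi> dm m(3)])
      finally have e: "f' (\<phi> x + h) - f' (\<phi> x) - L' h = \<psi> (f (x + a) - f x - L a)" .
      have "f (x + a) - f x - L a \<in> level F 0" using dm m(3) sF by (simp add: subspace_diff)
      then have "lnorm F' 0 (f' (\<phi> x + h) - f' (\<phi> x) - L' h) = lnorm F 0 (f (x + a) - f x - L a)"
        unfolding e by (rule n\<psi>)
      moreover have "lnorm E' 1 h = lnorm E 1 a" unfolding a(2) by (rule n\<phi>[OF a(1)])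
      ultimately show ?thesis using d[OF a(1) xa] h(3,4) by simp
    qed
    then show ?thesis using \<open>\<delta> > 0\<close> by blast
  qed
  ultimately show ?thesis unfolding has_sc_derivative_iff[OF n(2)] by blast
qed

lemma T_space_simps [simp]:
  "level (T_space E) m = level E (Suc m) \<times> level E m"
  "lnorm (T_space E) m p = lnorm E (Suc m) (fst p) + lnorm E m (snd p)"
  by (simp_all add: T_space_def sc_sum_def sc_shift_def split: prod.split)

lemma sc_image_simps [simp]:
  "level (sc_image c d E) m = c ` level E m" "lnorm (sc_image c d E) m u = lnorm E m (d u)"
  by (simp_all add: sc_image_def)

lemma normed_scale_T_space:
  assumes "normed_scale E" shows "normed_scale (T_space E)"
proof -
  have "norm_on (level E (Suc m) \<times> level E m) (lnorm (T_space E) m)" for m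
    using norm_on_level[OF assms, of m] norm_on_level[OF assms, of "Suc m"]
    unfolding norm_on_def
    by (auto simp: subspace_Times zero_prod_def add_nonneg_eq_0_iff distrib_left intro: add_mono)
       (smt (verit))+
  moreover have "level E (Suc (Suc m)) \<times> level E (Suc m) \<subseteq> level E (Suc m) \<times> level E m" for m
    using assms by (auto simp: normed_scale_def)
  ultimately show ?thesis by (auto simp: normed_scale_def)
qed

lemma scale_iso_T_space:
  assumes "scale_iso E F \<phi>" shows "scale_iso (T_space E) (T_space F) (map_prod \<phi> \<phi>)"
proof -
  have E: "normed_scale E" and F: "normed_scale F" using assms by (auto simp: scale_iso_def)
  have *: "x \<in> level E 0" if "x \<in> level E m" for x m using level_0[OF E that] .
  show ?thesis
    unfolding scale_iso_def
  proof (intro conjI allI ballI)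
    show "normed_scale (T_space E)" "normed_scale (T_space F)" using E F by (auto intro: normed_scale_T_space)
    have mem: "\<phi> x \<in> level F m" if "x \<in> level E m" for x m
      using assms that unfolding scale_iso_def by blast
    have lin: "linear_between (level E 0) (level F 0) \<phi>" using assms by (simp add: scale_iso_def)
    have "\<phi> (x + y) = \<phi> x + \<phi> y" "\<phi> (c *\<^sub>R x) = c *\<^sub>R \<phi> x" if "x \<in> level E 0" "y \<in> level E 0" for x y c
      using lin that by (simp_all add: linear_between_def)
    then show "linear_between (level (T_space E) 0) (level (T_space F) 0) (map_prod \<phi> \<phi>)"
      unfolding linear_between_def using mem * by (simp add: scaleR_prod_def image_subset_iff)
    show "inj_on (map_prod \<phi> \<phi>) (level (T_space E) 0)"
      using assms * unfolding scale_iso_def by (auto simp: inj_on_def)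
    show "map_prod \<phi> \<phi> ` level (T_space E) m = level (T_space F) m" for m
      using assms by (simp add: scale_iso_def map_prod_surj_on)
    show "lnorm (T_space F) m (map_prod \<phi> \<phi> x) = lnorm (T_space E) m x" if "x \<in> level (T_space E) m" for m x
      using assms that by (auto simp: scale_iso_def)
  qed
qed

lemma T_set_transport:
  assumes "scale_iso E F \<phi>" "U \<subseteq> level E 0"
  shows "map_prod \<phi> \<phi> ` T_set E U = T_set F (\<phi> ` U)"
proof -
  have "\<phi> ` (U \<inter> level E 1) = \<phi> ` U \<inter> \<phi> ` level E 1"
    using assms level_antimono[of E 0 1] unfolding scale_iso_def
    by (intro inj_on_image_Int[of \<phi> "level E 0"]) auto
  then show ?thesis using assms by (simp add: T_set_def scale_iso_def map_prod_surj_on)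
qed

lemma scale_iso_sc_image:
  assumes E: "normed_scale E" and add: "\<And>x y. c (x + y) = c x + c y"
    and sc: "\<And>r x. c (r *\<^sub>R x) = r *\<^sub>R c x" and dc: "\<And>x. d (c x) = x"
  shows "scale_iso E (sc_image c d E) c"
proof -
  have "linear c" using add sc by (rule linearI)
  then have sub: "subspace (c ` S)" if "subspace S" for S
    using that by (simp add: linear_subspace_image)
  have c0: "c x = 0 \<longleftrightarrow> x = 0" for x using \<open>linear c\<close> dc by (metis linear_0)
  have "norm_on (c ` level E m) (\<lambda>u. lnorm E m (d u))" for m
    using norm_on_level[OF E, of m] unfolding norm_on_def
    by (auto simp: sub dc c0 add[symmetric] sc[symmetric])
  then have "normed_scale (sc_image c d E)"
    using E unfolding normed_scale_def by (auto simp: sc_image_def)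
  moreover have "inj_on c (level E 0)" using dc by (metis inj_on_inverseI)
  ultimately show ?thesis
    using E add sc dc by (simp add: scale_iso_def linear_between_def)
qed

lemma scale_iso_cong:
  assumes \<phi>: "scale_iso E F \<phi>" and eq: "\<And>x. x \<in> level E 0 \<Longrightarrow> \<psi> x = \<phi> x"
  shows "scale_iso E F \<psi>"
proof -
  have n: "normed_scale E" using \<phi> by (simp add: scale_iso_def)
  have eqm: "\<psi> x = \<phi> x" if "x \<in> level E m" for x m using eq level_0[OF n that] .
  have "linear_between (level E 0) (level F 0) \<psi>"
    using \<phi> level_subspace[OF n, of 0] unfolding scale_iso_def linear_between_def
    by (simp add: eq subspace_add subspace_scale image_subset_iff)
  moreover have "inj_on \<psi> (level E 0)" using \<phi> eq by (simp add: scale_iso_def cong: inj_on_cong)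
  moreover have "\<psi> ` level E m = \<phi> ` level E m" for m by (rule image_cong) (simp_all add: eqm)
  ultimately show ?thesis using \<phi> eqm by (simp add: scale_iso_def)
qed

lemma scale_iso_sc_image_inv:
  assumes i: "scale_iso E (sc_image c d E) c" and dc: "\<And>x. d (c x) = x"
  shows "scale_iso (sc_image c d E) E d"
proof (rule scale_iso_cong[OF scale_iso_inv[OF i]])
  fix u assume "u \<in> level (sc_image c d E) 0"
  then obtain x where "x \<in> level E 0" "u = c x" by auto
  then show "d u = inv_into (level E 0) c u"
    using dc i by (simp add: scale_iso_def)
qed

lemma lookup_scaleR: "Poly_Mapping.lookup (r *\<^sub>R u) i = r *\<^sub>R Poly_Mapping.lookup u i"
proof -
  have "finite {i. r *\<^sub>R Poly_Mapping.lookup u i \<noteq> 0}"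
    by (rule finite_subset[OF _ finite_lookup[of u]]) auto
  then show ?thesis by (simp add: scaleR_poly_mapping_def Abs_poly_mapping_inverse)
qed

lemma inj_double: "inj (\<lambda>n::nat. 2 * n)" "inj (\<lambda>n::nat. 2 * n + 1)"
  by (auto simp: inj_def)

lemma lookup_unweave:
  "Poly_Mapping.lookup (fst (unweave u)) n = Poly_Mapping.lookup u (2 * n)"
  "Poly_Mapping.lookup (snd (unweave u)) n = Poly_Mapping.lookup u (2 * n + 1)"
  using inj_double by (simp_all add: unweave_def map_key.rep_eq)

lemma bij_unweave: "bij (unweave :: 'a::zero fin_seq \<Rightarrow> _)"
proof (rule bijI)
  show "inj (unweave :: 'a fin_seq \<Rightarrow> _)"
  proof (rule injI, rule poly_mapping_eqI)
    fix u v :: "'a fin_seq" and k assume eq: "unweave u = unweave v"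
    show "Poly_Mapping.lookup u k = Poly_Mapping.lookup v k"
    proof (cases "even k")
      case True
      then have "k = 2 * (k div 2)" by simp
      then show ?thesis using lookup_unweave(1) eq by metis
    next
      case False
      then have "k = 2 * (k div 2) + 1" by simp
      then show ?thesis using lookup_unweave(2) eq by metis
    qed
  qed
  show "surj (unweave :: 'a fin_seq \<Rightarrow> _)"
  proof -
    have "\<exists>u. unweave u = p" for p :: "'a fin_seq \<times> 'a fin_seq"
    proof -
    define w where "w = (\<lambda>p :: 'a fin_seq \<times> 'a fin_seq. \<lambda>n.
      if even n then Poly_Mapping.lookup (fst p) (n div 2) else Poly_Mapping.lookup (snd p) (n div 2))"
    have "{n. w p n \<noteq> 0} \<subseteq> (\<lambda>n. 2 * n) ` {n. Poly_Mapping.lookup (fst p) n \<noteq> 0}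
      \<union> (\<lambda>n. 2 * n + 1) ` {n. Poly_Mapping.lookup (snd p) n \<noteq> 0}"
    proof
      fix n assume n: "n \<in> {n. w p n \<noteq> 0}"
      show "n \<in> (\<lambda>n. 2 * n) ` {n. Poly_Mapping.lookup (fst p) n \<noteq> 0}
        \<union> (\<lambda>n. 2 * n + 1) ` {n. Poly_Mapping.lookup (snd p) n \<noteq> 0}"
      proof (cases "even n")
        case True
        then have "n = 2 * (n div 2)" "Poly_Mapping.lookup (fst p) (n div 2) \<noteq> 0" using n by (auto simp: w_def)
        then show ?thesis by blast
      next
        case False
        then have "n = 2 * (n div 2) + 1" "Poly_Mapping.lookup (snd p) (n div 2) \<noteq> 0" using n by (auto simp: w_def)
        then show ?thesis by blast
      qed
    qed
    then have "finite {n. w p n \<noteq> 0}"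
      by (rule finite_subset) simp
    then have "Poly_Mapping.lookup (Abs_poly_mapping (w p)) = w p"
      by (simp add: Abs_poly_mapping_inverse)
    then have "unweave (Abs_poly_mapping (w p)) = p"
      by (intro prod_eqI poly_mapping_eqI) (simp_all only: lookup_unweave, simp_all add: w_def)
    then show ?thesis ..
    qed
    then show ?thesis unfolding surj_def by metis
  qed
qed

lemma unweave_weave [simp]: "unweave (weave p) = p"
  unfolding weave_def by (rule f_the_inv_into_f_bij_betw[OF bij_unweave]) simp

lemma weave_unweave [simp]: "weave (unweave u) = u"
  unfolding weave_def by (rule the_inv_f_f[OF bij_is_inj[OF bij_unweave]])

lemma unweave_add: "unweave (u + v) = unweave u + unweave v"
  by (intro prod_eqI poly_mapping_eqI) (simp_all add: lookup_unweave lookup_add)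

lemma unweave_scaleR: "unweave (r *\<^sub>R u) = r *\<^sub>R unweave u"
  by (intro prod_eqI poly_mapping_eqI) (simp_all add: lookup_unweave lookup_scaleR)

lemma scale_iso_weave: "normed_scale E \<Longrightarrow> scale_iso E (sc_image weave unweave E) weave"
proof (rule scale_iso_sc_image)
  show "weave (x + y) = weave x + weave y" for x y :: "'a fin_seq \<times> 'a fin_seq"
    using unweave_add[of "weave x" "weave y"] by (metis unweave_weave weave_unweave)
  show "weave (r *\<^sub>R x) = r *\<^sub>R weave x" for r and x :: "'a fin_seq \<times> 'a fin_seq"
    using unweave_scaleR[of r "weave x"] by (metis unweave_weave weave_unweave)
qed auto

lemma scale_iso_code0: "normed_scale E \<Longrightarrow> scale_iso E (sc_image code0 decode0 E) code0"
proof (rule scale_iso_sc_image)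
  show "code0 (r *\<^sub>R x) = r *\<^sub>R code0 x" for r and x :: 'a
    by (rule poly_mapping_eqI) (simp add: lookup_scaleR lookup_single when_def)
qed (auto simp: single_add)

lemma T_set_subset:
  "normed_scale E \<Longrightarrow> T_set E U \<subseteq> level (T_space E) 0"
  by (auto simp: T_set_def)

lemma T_derivative_transport:
  assumes \<phi>: "scale_iso E E' \<phi>" and \<psi>: "scale_iso F F' \<psi>" and U: "U \<subseteq> level E 0"
    and f: "f ` U \<subseteq> level F 0" and f0': "\<forall>x\<in>U. f' (\<phi> x) = \<psi> (f x)"
    and D0: "\<forall>x \<in> U \<inter> level E 1. has_sc_derivative E U F f x (D x)"
  shows "\<exists>D'. (\<forall>x \<in> \<phi> ` U \<inter> level E' 1. has_sc_derivative E' (\<phi> ` U) F' f' x (D' x)) \<and>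
    (\<forall>p \<in> T_set E U. T_with f' D' (map_prod \<phi> \<phi> p) = map_prod \<psi> \<psi> (T_with f D p))"
proof (intro exI conjI ballI)
  note f' = bspec[OF f0'] and D = bspec[OF D0]
  let ?i = "inv_into (level E 0) \<phi>"
  define D' where "D' = (\<lambda>x h. \<psi> (D (?i x) (?i h)))"
  have inj: "inj_on \<phi> (level E 0)" and im: "level E' 1 = \<phi> ` level E 1" and E: "normed_scale E"
    using \<phi> by (auto simp: scale_iso_def)
  show "has_sc_derivative E' (\<phi> ` U) F' f' x (D' x)" if x: "x \<in> \<phi> ` U \<inter> level E' 1" for x
  proof -
    obtain y z where y: "y \<in> U" "x = \<phi> y" and z: "z \<in> level E 1" "x = \<phi> z" using x im by auto
    have "y = z" using y z inj U level_0[OF E z(1)] by (metis inj_onD subsetD)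
    then have y1: "y \<in> U \<inter> level E 1" using y z by blast
    have "D' (\<phi> y) (\<phi> h) = \<psi> (D y h)" if "h \<in> level E 0" for h
      using inj that y U by (auto simp: D'_def)
    then show ?thesis
      unfolding y(2) using has_sc_derivative_transport[OF \<phi> \<psi> U f f0' _ y1 D[OF y1]] by blast
  qed
  show "T_with f' D' (map_prod \<phi> \<phi> p) = map_prod \<psi> \<psi> (T_with f D p)" if "p \<in> T_set E U" for p
    using that U inj f' by (auto simp: T_with_def T_set_def D'_def)
qed

lemma sc0_image: "normed_scale E \<Longrightarrow> normed_scale F \<Longrightarrow> U \<subseteq> level E 0 \<Longrightarrow> sc0 E U F V f \<Longrightarrow> f ` U \<subseteq> level F 0"
  unfolding sc0_iff by (auto dest: spec[of _ 0])

lemma scale_iso_coded: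
  assumes "scale_iso G G' \<theta>"
  shows "scale_iso (sc_image weave unweave (T_space G)) (sc_image weave unweave (T_space G'))
      (weave \<circ> map_prod \<theta> \<theta> \<circ> unweave)"
proof -
  have G: "normed_scale (T_space G)" "normed_scale (T_space G')"
    using assms by (auto simp: scale_iso_def intro: normed_scale_T_space)
  have "scale_iso (sc_image weave unweave (T_space G)) (T_space G) unweave"
    by (rule scale_iso_sc_image_inv[OF scale_iso_weave[OF G(1)]]) simp
  then show ?thesis
    using scale_iso_comp[OF scale_iso_comp[OF _ scale_iso_T_space[OF assms]] scale_iso_weave[OF G(2)]]
    by (simp add: comp_assoc)
qed

lemma sc_k_coded_transport:
  assumes "scale_iso E E' \<phi>" "scale_iso F F' \<psi>" "U \<subseteq> level E 0" "V \<subseteq> level F 0"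
    and "\<forall>x\<in>U. f' (\<phi> x) = \<psi> (f x)" and "sc_k_coded k E U F V f"
  shows "sc_k_coded k E' (\<phi> ` U) F' (\<psi> ` V) f'"
  using assms
proof (induction k arbitrary: E E' F F' U V f f' \<phi> \<psi>)
  case 0
  have f: "sc0 E U F V f" using "0.prems"(6) by simp
  show ?case unfolding sc_k_coded.simps by (rule sc0_transport[OF "0.prems"(1-5) f])
next
  case (Suc k)
  note \<phi> = Suc.prems(1) and \<psi> = Suc.prems(2) and U = Suc.prems(3) and V = Suc.prems(4) and f' = Suc.prems(5)
  have n: "normed_scale E" "normed_scale E'" "normed_scale F" "normed_scale F'"
    using \<phi> \<psi> by (auto simp: scale_iso_def)
  obtain D where f0: "sc0 E U F V f" and D: "\<forall>x \<in> U \<inter> level E 1. has_sc_derivative E U F f x (D x)"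
    and T: "sc_k_coded k (sc_image weave unweave (T_space E)) (weave ` T_set E U)
            (sc_image weave unweave (T_space F)) (weave ` T_set F V) (weave \<circ> T_with f D \<circ> unweave)"
    using Suc.prems(6) unfolding sc_k_coded.simps by blast
  obtain D' where D': "\<forall>x \<in> \<phi> ` U \<inter> level E' 1. has_sc_derivative E' (\<phi> ` U) F' f' x (D' x)"
    and T': "\<forall>p \<in> T_set E U. T_with f' D' (map_prod \<phi> \<phi> p) = map_prod \<psi> \<psi> (T_with f D p)"
    using T_derivative_transport[OF \<phi> \<psi> U sc0_image[OF n(1) n(3) U f0] f' D] by blast
  have im: "(weave \<circ> map_prod \<phi> \<phi> \<circ> unweave) ` weave ` T_set E U = weave ` T_set E' (\<phi> ` U)"
    "(weave \<circ> map_prod \<psi> \<psi> \<circ> unweave) ` weave ` T_set F V = weave ` T_set F' (\<psi> ` V)"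
    unfolding T_set_transport[OF \<phi> U, symmetric] T_set_transport[OF \<psi> V, symmetric]
    by (simp_all add: image_image)
  have "sc_k_coded k (sc_image weave unweave (T_space E'))
      ((weave \<circ> map_prod \<phi> \<phi> \<circ> unweave) ` weave ` T_set E U) (sc_image weave unweave (T_space F'))
      ((weave \<circ> map_prod \<psi> \<psi> \<circ> unweave) ` weave ` T_set F V) (weave \<circ> T_with f' D' \<circ> unweave)"
  proof (rule Suc.IH[OF _ _ _ _ _ T])
    show "scale_iso (sc_image weave unweave (T_space E)) (sc_image weave unweave (T_space E'))
        (weave \<circ> map_prod \<phi> \<phi> \<circ> unweave)"
      by (rule scale_iso_coded[OF \<phi>])
    show "scale_iso (sc_image weave unweave (T_space F)) (sc_image weave unweave (T_space F'))
        (weave \<circ> map_prod \<psi> \<psi> \<circ> unweave)"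
      by (rule scale_iso_coded[OF \<psi>])
    show "weave ` T_set E U \<subseteq> level (sc_image weave unweave (T_space E)) 0"
      "weave ` T_set F V \<subseteq> level (sc_image weave unweave (T_space F)) 0"
      using T_set_subset[OF n(1)] T_set_subset[OF n(3)] by (simp_all only: sc_image_simps image_mono)
    show "\<forall>x \<in> weave ` T_set E U. (weave \<circ> T_with f' D' \<circ> unweave) ((weave \<circ> map_prod \<phi> \<phi> \<circ> unweave) x) =
        (weave \<circ> map_prod \<psi> \<psi> \<circ> unweave) ((weave \<circ> T_with f D \<circ> unweave) x)"
    proof (intro ballI, elim imageE)
      fix x p assume "x = weave p" "p \<in> T_set E U"
      then show "(weave \<circ> T_with f' D' \<circ> unweave) ((weave \<circ> map_prod \<phi> \<phi> \<circ> unweave) x) =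
          (weave \<circ> map_prod \<psi> \<psi> \<circ> unweave) ((weave \<circ> T_with f D \<circ> unweave) x)"
        using bspec[OF T', of p] by simp
    qed
  qed
  then have "sc_k_coded k (sc_image weave unweave (T_space E')) (weave ` T_set E' (\<phi> ` U))
      (sc_image weave unweave (T_space F')) (weave ` T_set F' (\<psi> ` V)) (weave \<circ> T_with f' D' \<circ> unweave)"
    by (simp only: im)
  moreover have "sc0 E' (\<phi> ` U) F' (\<psi> ` V) f'"
    by (rule sc0_transport[OF \<phi> \<psi> U V f' f0])
  ultimately show ?case unfolding sc_k_coded.simps using D' by blast
qed

lemma sc_k_0:
  assumes E: "normed_scale E" and F: "normed_scale F" and U: "U \<subseteq> level E 0" and V: "V \<subseteq> level F 0"
  shows "sc_k 0 E U F V f \<longleftrightarrow> sc0 E U F V f"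
proof
  note iE = scale_iso_code0[OF E]
  note iF = scale_iso_code0[OF F]
  show "sc_k 0 E U F V f" if "sc0 E U F V f"
    unfolding sc_k_def sc_k_coded.simps by (rule sc0_transport[OF iE iF U V _ that]) simp
  assume "sc_k 0 E U F V f"
  then have c: "sc0 (sc_image code0 decode0 E) (code0 ` U) (sc_image code0 decode0 F) (code0 ` V)
      (code0 \<circ> f \<circ> decode0)" by (simp add: sc_k_def)
  have "sc0 E (decode0 ` code0 ` U) F (decode0 ` code0 ` V) f"
    using U V by (intro sc0_transport[OF scale_iso_sc_image_inv[OF iE] scale_iso_sc_image_inv[OF iF] _ _ _ c]) auto
  then show "sc0 E U F V f" by (simp add: image_image)
qed

lemma sc_k_Suc:
  assumes E: "normed_scale E" and F: "normed_scale F" and U: "U \<subseteq> level E 0" and V: "V \<subseteq> level F 0"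
  shows "sc_k (Suc k) E U F V f \<longleftrightarrow> sc0 E U F V f \<and>
    (\<exists>D. (\<forall>x \<in> U \<inter> level E 1. has_sc_derivative E U F f x (D x)) \<and>
         sc_k k (T_space E) (T_set E U) (T_space F) (T_set F V) (T_with f D))"
proof -
  let ?cE = "sc_image code0 decode0 E" and ?cF = "sc_image code0 decode0 F"
  let ?f = "code0 \<circ> f \<circ> decode0"
  have nE: "normed_scale E" and nF: "normed_scale F" using E F .
  note iE = scale_iso_code0[OF nE] and iF = scale_iso_code0[OF nF]
  note dE = scale_iso_sc_image_inv[OF iE lookup_single_eq] and dF = scale_iso_sc_image_inv[OF iF lookup_single_eq]
  have nc: "normed_scale ?cE" "normed_scale ?cF" using iE iF by (auto simp: scale_iso_def)
  note nT = normed_scale_T_space[OF nE] normed_scale_T_space[OF nF]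
    normed_scale_T_space[OF nc(1)] normed_scale_T_space[OF nc(2)]
  note cTE = scale_iso_code0[OF nT(1)] and cTF = scale_iso_code0[OF nT(2)]
  note wE = scale_iso_weave[OF nT(3)] and wF = scale_iso_weave[OF nT(4)]
  have cU: "code0 ` U \<subseteq> level ?cE 0" and cV: "code0 ` V \<subseteq> level ?cF 0" using U V by auto
  have TU: "T_set ?cE (code0 ` U) = map_prod code0 code0 ` T_set E U"
    "T_set ?cF (code0 ` V) = map_prod code0 code0 ` T_set F V"
    using T_set_transport[OF iE U] T_set_transport[OF iF V] by simp_all
  have sub: "T_set E U \<subseteq> level (T_space E) 0" "T_set F V \<subseteq> level (T_space F) 0"
    "T_set ?cE (code0 ` U) \<subseteq> level (T_space ?cE) 0" "T_set ?cF (code0 ` V) \<subseteq> level (T_space ?cF) 0"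
    using T_set_subset nE nF nc by blast+
  show ?thesis
  proof
    assume "sc_k (Suc k) E U F V f"
    then obtain D where f0: "sc0 ?cE (code0 ` U) ?cF (code0 ` V) ?f"
      and D: "\<forall>x \<in> code0 ` U \<inter> level ?cE 1. has_sc_derivative ?cE (code0 ` U) ?cF ?f x (D x)"
      and T: "sc_k_coded k (sc_image weave unweave (T_space ?cE)) (weave ` T_set ?cE (code0 ` U))
        (sc_image weave unweave (T_space ?cF)) (weave ` T_set ?cF (code0 ` V)) (weave \<circ> T_with ?f D \<circ> unweave)"
      unfolding sc_k_def sc_k_coded.simps by blast
    have dc: "decode0 ` code0 ` X = X" for X :: "'z::zero set" by (simp add: image_image)
    have f1: "\<forall>x \<in> code0 ` U. f (decode0 x) = decode0 (?f x)" by simp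
    have f0': "sc0 E U F V f"
      using sc0_transport[OF dE dF cU cV f1 f0] by (simp only: dc)
    obtain D' where D': "\<forall>x \<in> decode0 ` code0 ` U \<inter> level E 1. has_sc_derivative E (decode0 ` code0 ` U) F f x (D' x)"
      and T': "\<forall>p \<in> T_set ?cE (code0 ` U).
        T_with f D' (map_prod decode0 decode0 p) = map_prod decode0 decode0 (T_with ?f D p)"
      using T_derivative_transport[OF dE dF cU sc0_image[OF nc cU f0] f1 D] by blast
    note iso = scale_iso_comp[OF scale_iso_comp[OF scale_iso_sc_image_inv[OF wE unweave_weave]
        scale_iso_T_space[OF dE]] cTE]
      scale_iso_comp[OF scale_iso_comp[OF scale_iso_sc_image_inv[OF wF unweave_weave]
        scale_iso_T_space[OF dF]] cTF]
    have "sc_k_coded k (sc_image code0 decode0 (T_space E))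
        ((code0 \<circ> (map_prod decode0 decode0 \<circ> unweave)) ` weave ` T_set ?cE (code0 ` U))
        (sc_image code0 decode0 (T_space F))
        ((code0 \<circ> (map_prod decode0 decode0 \<circ> unweave)) ` weave ` T_set ?cF (code0 ` V))
        (code0 \<circ> T_with f D' \<circ> decode0)"
    proof (rule sc_k_coded_transport[OF iso _ _ _ T])
      show "weave ` T_set ?cE (code0 ` U) \<subseteq> level (sc_image weave unweave (T_space ?cE)) 0"
        "weave ` T_set ?cF (code0 ` V) \<subseteq> level (sc_image weave unweave (T_space ?cF)) 0"
        using sub(3,4) by (simp_all only: sc_image_simps image_mono)
    qed (use T' in auto)
    moreover have "(code0 \<circ> (map_prod decode0 decode0 \<circ> unweave)) ` weave ` T_set ?cE (code0 ` U) = code0 ` T_set E U"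
      "(code0 \<circ> (map_prod decode0 decode0 \<circ> unweave)) ` weave ` T_set ?cF (code0 ` V) = code0 ` T_set F V"
      unfolding TU by (simp_all add: image_image map_prod_def split_beta)
    ultimately have "sc_k k (T_space E) (T_set E U) (T_space F) (T_set F V) (T_with f D')"
      by (simp only: sc_k_def)
    with f0' D' show "sc0 E U F V f \<and> (\<exists>D. (\<forall>x \<in> U \<inter> level E 1. has_sc_derivative E U F f x (D x)) \<and>
         sc_k k (T_space E) (T_set E U) (T_space F) (T_set F V) (T_with f D))"
      by (auto simp only: dc)
  next
    assume "sc0 E U F V f \<and> (\<exists>D. (\<forall>x \<in> U \<inter> level E 1. has_sc_derivative E U F f x (D x)) \<and>
         sc_k k (T_space E) (T_set E U) (T_space F) (T_set F V) (T_with f D))"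
    then obtain D where f0: "sc0 E U F V f"
      and D: "\<forall>x \<in> U \<inter> level E 1. has_sc_derivative E U F f x (D x)"
      and T: "sc_k_coded k (sc_image code0 decode0 (T_space E)) (code0 ` T_set E U)
        (sc_image code0 decode0 (T_space F)) (code0 ` T_set F V) (code0 \<circ> T_with f D \<circ> decode0)"
      unfolding sc_k_def by blast
    have f1: "\<forall>x\<in>U. ?f (code0 x) = code0 (f x)" by simp
    obtain D' where D': "\<forall>x \<in> code0 ` U \<inter> level ?cE 1. has_sc_derivative ?cE (code0 ` U) ?cF ?f x (D' x)"
      and T': "\<forall>p \<in> T_set E U.
        T_with ?f D' (map_prod code0 code0 p) = map_prod code0 code0 (T_with f D p)"
      using T_derivative_transport[OF iE iF U sc0_image[OF nE nF U f0] f1 D] by blast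
    note iso = scale_iso_comp[OF scale_iso_comp[OF scale_iso_sc_image_inv[OF cTE lookup_single_eq]
        scale_iso_T_space[OF iE]] wE]
      scale_iso_comp[OF scale_iso_comp[OF scale_iso_sc_image_inv[OF cTF lookup_single_eq]
        scale_iso_T_space[OF iF]] wF]
    have "sc_k_coded k (sc_image weave unweave (T_space ?cE))
        ((weave \<circ> (map_prod code0 code0 \<circ> decode0)) ` code0 ` T_set E U)
        (sc_image weave unweave (T_space ?cF))
        ((weave \<circ> (map_prod code0 code0 \<circ> decode0)) ` code0 ` T_set F V)
        (weave \<circ> T_with ?f D' \<circ> unweave)"
    proof (rule sc_k_coded_transport[OF iso _ _ _ T])
      show "code0 ` T_set E U \<subseteq> level (sc_image code0 decode0 (T_space E)) 0"
        "code0 ` T_set F V \<subseteq> level (sc_image code0 decode0 (T_space F)) 0"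
        using sub(1,2) by (simp_all only: sc_image_simps image_mono)
    qed (use T' in auto)
    moreover have "(weave \<circ> (map_prod code0 code0 \<circ> decode0)) ` code0 ` T_set E U = weave ` T_set ?cE (code0 ` U)"
      "(weave \<circ> (map_prod code0 code0 \<circ> decode0)) ` code0 ` T_set F V = weave ` T_set ?cF (code0 ` V)"
      unfolding TU by (simp_all add: image_image)
    moreover have "sc0 ?cE (code0 ` U) ?cF (code0 ` V) ?f"
      by (rule sc0_transport[OF iE iF U V f1 f0])
    ultimately show "sc_k (Suc k) E U F V f"
      using D' unfolding sc_k_def sc_k_coded.simps by (metis (no_types, lifting))
  qed
qed

corollary sc_k_1:
  assumes E: "normed_scale E" and F: "normed_scale F" and U: "U \<subseteq> level E 0" and V: "V \<subseteq> level F 0"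
  shows "sc_k 1 E U F V f \<longleftrightarrow> sc1 E U F V f"
  unfolding One_nat_def sc_k_Suc[OF assms]
    sc_k_0[OF normed_scale_T_space[OF E] normed_scale_T_space[OF F] T_set_subset[OF E] T_set_subset[OF F]]
  by (simp add: sc1_def)

end

theory Submission
  imports Defs
begin

text \<open>
  Everything rests on the chain rule for \<open>sc\<^sup>1\<close>-maps between relatively open subsets of partial
  quadrants, together with uniqueness of the sc-derivative.

  For the chain rule (\<open>chain_rule_derivative\<close>) write \<open>y = f x\<close> and \<open>v = f (x + h) - f x\<close>. The map
  \<open>(z, e) \<mapsto> Dg(z) e\<close> is only known to be continuous on \<open>F\<^sub>1 \<oplus> F\<^sub>0\<close>; in general \<open>z \<mapsto> Dg(z)\<close> is not
  continuous in operator norm, so the classical argument breaks down. What replaces it is the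
  compactness of \<open>E\<^sub>1 \<rightarrow> E\<^sub>0\<close>: up to an error of size \<open>o(\<bar>h\<bar>\<^sub>1)\<close> in \<open>F\<^sub>0\<close>, the quotient \<open>v / \<bar>h\<bar>\<^sub>1\<close> lies
  in the image of the unit ball of \<open>E\<^sub>1\<close> under \<open>Df(x)\<close>, which is totally bounded in \<open>F\<^sub>0\<close>, and on
  totally bounded sets pointwise convergence of locally equibounded operators is uniform
  (\<open>tangent_uniformly_continuous_on_ball\<close>). Since \<open>z \<rightarrow> y\<close> in \<open>F\<^sub>1\<close> along the segment from \<open>y\<close> to
  \<open>f (x + h)\<close>, a mean value inequality along that segment finishes the estimate.

  The derivative is unique (\<open>sc_derivative_unique\<close>) because a partial quadrant is a convex cone
  whose level-1 points span \<open>E\<^sub>1\<close>, and \<open>E\<^sub>1\<close> is dense in \<open>E\<^sub>0\<close>. Hence tangent maps, which are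
  built from a chosen derivative, compose on the nose (\<open>sc_chain_rule\<close>).

  For models \<open>O = r(U)\<close> and \<open>O' = s(V)\<close>, the map \<open>f \<circ> r\<close> takes values in \<open>O' \<subseteq> V\<close>, where \<open>s\<close> is the
  identity, so \<open>g \<circ> f \<circ> r = (g \<circ> s) \<circ> (f \<circ> r)\<close> and the chain rule applies. That the tangent map of
  \<open>f\<close> lands in \<open>TO' = Ts(TV)\<close> follows by the chain rule from \<open>f \<circ> r = s \<circ> (f \<circ> r)\<close>.
\<close>

section \<open>Estimates in a scale of normed spaces\<close>

lemma level_closed:
  assumes "normed_scale E"
  shows "0 \<in> level E m"
    and "x \<in> level E m \<Longrightarrow> y \<in> level E m \<Longrightarrow> x + y \<in> level E m"
    and "x \<in> level E m \<Longrightarrow> y \<in> level E m \<Longrightarrow> x - y \<in> level E m"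
    and "x \<in> level E m \<Longrightarrow> c *\<^sub>R x \<in> level E m"
  using level_subspace[OF assms, of m]
  by (auto intro: subspace_0 subspace_add subspace_diff subspace_scale)

lemma lnorm_nonneg: "normed_scale E \<Longrightarrow> x \<in> level E m \<Longrightarrow> 0 \<le> lnorm E m x"
  using norm_on_level[of E m] by (simp add: norm_on_def)

lemma lnorm_eq_0: "normed_scale E \<Longrightarrow> x \<in> level E m \<Longrightarrow> lnorm E m x = 0 \<longleftrightarrow> x = 0"
  using norm_on_level[of E m] by (simp add: norm_on_def)

lemma lnorm_zero: "normed_scale E \<Longrightarrow> lnorm E m 0 = 0"
  by (simp add: lnorm_eq_0 level_closed)

lemma lnorm_scaleR: "normed_scale E \<Longrightarrow> x \<in> level E m \<Longrightarrow> lnorm E m (c *\<^sub>R x) = \<bar>c\<bar> * lnorm E m x"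
  using norm_on_level[of E m] by (simp add: norm_on_def)

lemma lnorm_triangle:
  "normed_scale E \<Longrightarrow> x \<in> level E m \<Longrightarrow> y \<in> level E m \<Longrightarrow>
    lnorm E m (x + y) \<le> lnorm E m x + lnorm E m y"
  using norm_on_level[of E m] by (simp add: norm_on_def)

lemma lnorm_minus_commute:
  assumes "normed_scale E" "x \<in> level E m" "y \<in> level E m"
  shows "lnorm E m (x - y) = lnorm E m (y - x)"
  using lnorm_scaleR[OF assms(1) level_closed(3)[OF assms(1) assms(3,2)], of "-1"] by simp

lemma lnorm_triangle_diff:
  assumes E: "normed_scale E" and x: "x \<in> level E m" "y \<in> level E m"
  shows "lnorm E m (x - y) \<le> lnorm E m x + lnorm E m y"
  using lnorm_triangle[OF E x(1) level_closed(4)[OF E x(2), of "-1"]] lnorm_scaleR[OF E x(2), of "-1"]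
  by simp

lemma linear_betweenD:
  assumes "linear_between S T L"
  shows "x \<in> S \<Longrightarrow> L x \<in> T" "x \<in> S \<Longrightarrow> y \<in> S \<Longrightarrow> L (x + y) = L x + L y"
    "x \<in> S \<Longrightarrow> L (c *\<^sub>R x) = c *\<^sub>R L x"
  using assms by (auto simp: linear_between_def)

text \<open>Linear bounds are only useful with a positive constant, which can always be arranged.\<close>

lemma positive_bound:
  assumes E: "normed_scale E" and "\<exists>B. \<forall>h\<in>level E m. n h \<le> B * lnorm E m h"
  shows "\<exists>B>0. \<forall>h\<in>level E m. n h \<le> B * lnorm E m h"
proof -
  obtain B where B: "\<forall>h\<in>level E m. n h \<le> B * lnorm E m h" using assms(2) by blast
  have "n h \<le> (\<bar>B\<bar> + 1) * lnorm E m h" if "h \<in> level E m" for h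
  proof -
    have "B * lnorm E m h \<le> (\<bar>B\<bar> + 1) * lnorm E m h"
      using lnorm_nonneg[OF E that] by (intro mult_right_mono) auto
    then show ?thesis using B that by force
  qed
  then show ?thesis by (intro exI[of _ "\<bar>B\<bar> + 1"]) auto
qed

text \<open>Multiplying out the difference quotient makes the increment \<open>h = 0\<close> admissible, so that the
  estimates below need no case distinction.\<close>

lemma has_sc_derivative_iff_little_o:
  assumes E: "normed_scale E" and F: "normed_scale F" and x: "x \<in> U" and f: "f ` U \<subseteq> level F 0"
  shows "has_sc_derivative E U F f x L \<longleftrightarrow>
     linear_between (level E 0) (level F 0) L \<and>
     (\<exists>B. \<forall>h\<in>level E 0. lnorm F 0 (L h) \<le> B * lnorm E 0 h) \<and>
     (\<forall>\<epsilon>>0. \<exists>\<delta>>0. \<forall>h \<in> level E 1. x + h \<in> U \<and> lnorm E 1 h < \<delta> \<longrightarrow>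
        lnorm F 0 (f (x + h) - f x - L h) \<le> \<epsilon> * lnorm E 1 h)"
    (is "_ \<longleftrightarrow> ?lin \<and> ?bd \<and> ?o")
proof -
  let ?q = "\<forall>\<epsilon>>0. \<exists>\<delta>>0. \<forall>h \<in> level E 1. x + h \<in> U \<and> 0 < lnorm E 1 h \<and> lnorm E 1 h < \<delta> \<longrightarrow>
        \<bar>lnorm F 0 (f (x + h) - f x - L h) / lnorm E 1 h\<bar> < \<epsilon>"
  have "?q \<longleftrightarrow> ?o" if lin: ?lin
  proof
    assume q: ?q
    show ?o
    proof (intro allI impI)
      fix \<epsilon> :: real assume "\<epsilon> > 0"
      then obtain \<delta> where "\<delta> > 0" and d: "\<And>h. h \<in> level E 1 \<Longrightarrow> x + h \<in> U \<Longrightarrow> 0 < lnorm E 1 h \<Longrightarrow>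
          lnorm E 1 h < \<delta> \<Longrightarrow> \<bar>lnorm F 0 (f (x + h) - f x - L h) / lnorm E 1 h\<bar> < \<epsilon>"
        using q by blast
      have "lnorm F 0 (f (x + h) - f x - L h) \<le> \<epsilon> * lnorm E 1 h"
        if h: "h \<in> level E 1" "x + h \<in> U" "lnorm E 1 h < \<delta>" for h
      proof (cases "h = 0")
        case True
        have "L 0 = 0"
          using linear_betweenD(3)[OF lin level_closed(1)[OF E], of 0] by simp
        then show ?thesis using True by (simp add: lnorm_zero[OF E] lnorm_zero[OF F])
      next
        case False
        then have p: "0 < lnorm E 1 h"
          using lnorm_nonneg[OF E h(1)] lnorm_eq_0[OF E h(1)] by linarith
        have "lnorm F 0 (f (x + h) - f x - L h) / lnorm E 1 h < \<epsilon>"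
          using d[OF h(1,2) p h(3)] by linarith
        then show ?thesis using p by (simp add: divide_simps)
      qed
      then show "\<exists>\<delta>>0. \<forall>h \<in> level E 1. x + h \<in> U \<and> lnorm E 1 h < \<delta> \<longrightarrow>
        lnorm F 0 (f (x + h) - f x - L h) \<le> \<epsilon> * lnorm E 1 h" using \<open>\<delta> > 0\<close> by blast
    qed
  next
    assume o: ?o
    show ?q
    proof (intro allI impI)
      fix \<epsilon> :: real assume "\<epsilon> > 0"
      then have "\<epsilon> / 2 > 0" by simp
      then obtain \<delta> where "\<delta> > 0" and d: "\<And>h. h \<in> level E 1 \<Longrightarrow> x + h \<in> U \<Longrightarrow>
          lnorm E 1 h < \<delta> \<Longrightarrow> lnorm F 0 (f (x + h) - f x - L h) \<le> \<epsilon> / 2 * lnorm E 1 h"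
        using o by blast
      have "\<bar>lnorm F 0 (f (x + h) - f x - L h) / lnorm E 1 h\<bar> < \<epsilon>"
        if h: "h \<in> level E 1" "x + h \<in> U" "0 < lnorm E 1 h" "lnorm E 1 h < \<delta>" for h
      proof -
        have "L h \<in> level F 0" using linear_betweenD(1)[OF lin] level_0[OF E h(1)] .
        then have "f (x + h) - f x - L h \<in> level F 0"
          using f x h(2) by (intro level_closed[OF F]) auto
        note n = lnorm_nonneg[OF F this]
        have "lnorm F 0 (f (x + h) - f x - L h) / lnorm E 1 h \<le> \<epsilon> / 2"
          using d[OF h(1,2,4)] h(3) by (simp add: divide_simps)
        moreover have "0 \<le> lnorm F 0 (f (x + h) - f x - L h) / lnorm E 1 h" using n h(3) by simp
        ultimately show ?thesis using \<open>\<epsilon> > 0\<close> by linarith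
      qed
      then show "\<exists>\<delta>>0. \<forall>h \<in> level E 1. x + h \<in> U \<and> 0 < lnorm E 1 h \<and> lnorm E 1 h < \<delta> \<longrightarrow>
        \<bar>lnorm F 0 (f (x + h) - f x - L h) / lnorm E 1 h\<bar> < \<epsilon>" using \<open>\<delta> > 0\<close> by blast
    qed
  qed
  then show ?thesis unfolding has_sc_derivative_iff[OF E] by blast
qed

section \<open>Compactness and density of the levels\<close>

text \<open>
  Compactness of \<open>E\<^sub>1 \<rightarrow> E\<^sub>0\<close> in the form of total boundedness, as the uniform estimates below use it.
\<close>

lemma finite_net_of_unit_ball:
  assumes E: "sc_banach E" and "\<eta> > 0"
  shows "\<exists>A. finite A \<and> A \<subseteq> level E 0 \<and>
    (\<forall>h\<in>level E 1. lnorm E 1 h \<le> 1 \<longrightarrow> (\<exists>a\<in>A. lnorm E 0 (h - a) < \<eta>))"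
proof -
  note n = sc_banach_normed_scale[OF E]
  interpret Metric_space "level E 0" "ldist E 0" by (rule Metric_space_level[OF n])
  let ?B = "{h \<in> level E 1. lnorm E 1 h \<le> 1}"
  have "compactin mtopology (mtopology closure_of ?B)"
    using E unfolding sc_banach_def level_top_def by (metis One_nat_def)
  then have "mtotally_bounded (mtopology closure_of ?B)" by (rule compactin_imp_mtotally_bounded)
  from this[unfolded mtotally_bounded_def, rule_format, OF \<open>\<eta> > 0\<close>]
  obtain A where A: "finite A" "A \<subseteq> mtopology closure_of ?B"
      "mtopology closure_of ?B \<subseteq> (\<Union>a\<in>A. mball a \<eta>)"
    by (elim exE conjE)
  have "A \<subseteq> level E 0" using A(2) closure_of_subset_topspace[of mtopology ?B] by auto
  moreover have "\<exists>a\<in>A. lnorm E 0 (h - a) < \<eta>" if h: "h \<in> level E 1" "lnorm E 1 h \<le> 1" for h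
  proof -
    have "?B \<subseteq> topspace mtopology" using level_0[OF n] by auto
    then have "h \<in> mtopology closure_of ?B" using closure_of_subset[of ?B mtopology] h by auto
    then obtain a where a: "a \<in> A" "h \<in> mball a \<eta>" using A(3) by blast
    then have "lnorm E 0 (a - h) < \<eta>" "a \<in> level E 0" "h \<in> level E 0" by (auto simp: ldist_def)
    then show ?thesis using a(1) lnorm_minus_commute[OF n] by metis
  qed
  ultimately show ?thesis using A(1) by blast
qed

text \<open>
  Compact operators are bounded: a finite 1-net of the unit ball of \<open>E\<^sub>1\<close> bounds its norm in \<open>E\<^sub>0\<close>.
\<close>

lemma level_inclusion_bounded:
  assumes E: "sc_banach E"
  shows "\<exists>B>0. \<forall>h\<in>level E 1. lnorm E 0 h \<le> B * lnorm E 1 h"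
proof -
  note n = sc_banach_normed_scale[OF E]
  obtain A where A: "finite A" "A \<subseteq> level E 0"
    and net: "\<And>h. h \<in> level E 1 \<Longrightarrow> lnorm E 1 h \<le> 1 \<Longrightarrow> \<exists>a\<in>A. lnorm E 0 (h - a) < 1"
    using finite_net_of_unit_ball[OF E, of 1] by auto
  define B where "B = 1 + (\<Sum>a\<in>A. lnorm E 0 a)"
  have unit: "lnorm E 0 h \<le> B" if h: "h \<in> level E 1" "lnorm E 1 h \<le> 1" for h
  proof -
    obtain a where a: "a \<in> A" "lnorm E 0 (h - a) < 1" using net[OF h] by blast
    have h0: "h \<in> level E 0" using level_0[OF n h(1)] .
    have "lnorm E 0 ((h - a) + a) \<le> lnorm E 0 (h - a) + lnorm E 0 a"
      using a A h0 by (intro lnorm_triangle[OF n] level_closed[OF n]) auto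
    moreover have "lnorm E 0 a \<le> (\<Sum>a\<in>A. lnorm E 0 a)"
      using A a(1) lnorm_nonneg[OF n] by (intro member_le_sum) auto
    ultimately show ?thesis using a(2) by (simp add: B_def)
  qed
  have "lnorm E 0 h \<le> B * lnorm E 1 h" if h: "h \<in> level E 1" for h
  proof (cases "h = 0")
    case True
    then show ?thesis by (simp add: lnorm_zero[OF n])
  next
    case False
    then have p: "0 < lnorm E 1 h" using lnorm_nonneg[OF n h] lnorm_eq_0[OF n h] by linarith
    have "lnorm E 0 ((1 / lnorm E 1 h) *\<^sub>R h) \<le> B"
      using h p by (intro unit level_closed[OF n]) (simp_all add: lnorm_scaleR[OF n])
    then show ?thesis
      using p by (simp add: lnorm_scaleR[OF n level_0[OF n h]] divide_simps)
  qed
  moreover have "B > 0" using A lnorm_nonneg[OF n] by (auto simp: B_def intro!: add_pos_nonneg sum_nonneg)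
  ultimately show ?thesis by blast
qed

lemma level_1_dense:
  assumes E: "sc_banach E" and h: "h \<in> level E 0" and "\<eta> > 0"
  shows "\<exists>k\<in>level E 1. lnorm E 0 (h - k) < \<eta>"
proof -
  note n = sc_banach_normed_scale[OF E]
  interpret Metric_space "level E 0" "ldist E 0" by (rule Metric_space_level[OF n])
  have "h \<in> mtopology closure_of smooth_points E"
    using E h unfolding sc_banach_def level_top_def by auto
  then obtain k where k: "k \<in> smooth_points E" "k \<in> mball h \<eta>"
    unfolding metric_closure_of using \<open>\<eta> > 0\<close> by blast
  then have "lnorm E 0 (h - k) < \<eta>" by (simp add: ldist_def split: if_splits)
  moreover have "k \<in> level E 1" using k by (auto simp: smooth_points_def)
  ultimately show ?thesis by blast
qed

lemma openin_level_ball: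
  assumes E: "normed_scale E" and C: "C \<subseteq> level E 0"
    and U: "openin (subtopology (level_top E 0) C) U" and x: "x \<in> U"
  shows "\<exists>\<delta>>0. \<forall>y\<in>C. lnorm E 0 (x - y) < \<delta> \<longrightarrow> y \<in> U"
proof -
  interpret Metric_space "level E 0" "ldist E 0" by (rule Metric_space_level[OF E])
  obtain T where T: "openin mtopology T" "U = T \<inter> C"
    using U by (auto simp: openin_subtopology level_top_def)
  then obtain \<delta> where "\<delta> > 0" and "mball x \<delta> \<subseteq> T"
    using x unfolding openin_mtopology by blast
  moreover have "y \<in> mball x \<delta>" if "y \<in> C" "lnorm E 0 (x - y) < \<delta>" for y
    using that x C T by (auto simp: ldist_def)
  ultimately show ?thesis using T by blast
qed

section \<open>The chain rule\<close>

text \<open>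
  The mean value inequality for a curve in a normed subspace, by bisection of the unit interval:
  the estimate for the increment over an interval is additive, so it suffices near each point.
\<close>

lemma norm_on_mean_value:
  assumes n: "norm_on S n" and \<phi>: "\<And>t. 0 \<le> t \<Longrightarrow> t \<le> 1 \<Longrightarrow> \<phi> t \<in> S" and w: "w \<in> S"
    and loc: "\<And>t. 0 \<le> t \<Longrightarrow> t \<le> 1 \<Longrightarrow> \<exists>\<delta>>0. \<forall>s. 0 \<le> s \<and> s \<le> 1 \<and> \<bar>s - t\<bar> < \<delta> \<longrightarrow>
      n (\<phi> s - \<phi> t - (s - t) *\<^sub>R w) \<le> c * \<bar>s - t\<bar>"
  shows "n (\<phi> 1 - \<phi> 0 - w) \<le> (c :: real)"
proof -
  have S: "subspace S" using n by (simp add: norm_on_def)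
  let ?d = "\<lambda>a b. \<phi> b - \<phi> a - (b - a) *\<^sub>R w"
  have dS: "?d a b \<in> S" if "0 \<le> a" "a \<le> 1" "0 \<le> b" "b \<le> 1" for a b
    using that \<phi> w S by (intro subspace_diff subspace_scale) auto
  have tri: "n (u + v) \<le> n u + n v" if "u \<in> S" "v \<in> S" for u v
    using n that by (simp add: norm_on_def)
  have neg: "n (?d a b) = n (?d b a)" if "0 \<le> a" "a \<le> 1" "0 \<le> b" "b \<le> 1" for a b
  proof -
    have "n ((-1) *\<^sub>R ?d b a) = \<bar>-1\<bar> * n (?d b a)"
      using n dS[OF that(3,4,1,2)] unfolding norm_on_def by blast
    moreover have "(-1) *\<^sub>R ?d b a = ?d a b" by (simp add: algebra_simps)
    ultimately show ?thesis by (simp only: abs_neg_one mult_1_left)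
  qed
  define P where "P = (\<lambda>a b. 0 \<le> a \<and> a \<le> b \<and> b \<le> 1 \<longrightarrow> n (?d a b) \<le> c * (b - a))"
  have glue: "n (?d a b) \<le> c * (b - a)"
    if "n (?d a x) \<le> c * (x - a)" "n (?d x b) \<le> c * (b - x)" "0 \<le> a" "a \<le> x" "x \<le> b" "b \<le> 1" for a x b
  proof -
    have "n (?d a x + ?d x b) \<le> n (?d a x) + n (?d x b)"
      using that by (intro tri dS) auto
    moreover have "?d a x + ?d x b = ?d a b" by (simp add: algebra_simps)
    ultimately show ?thesis using that(1,2) by (simp add: algebra_simps)
  qed
  have "(0::real) \<le> 1" by simp
  then have "P 0 1"
  proof (induction rule: Bolzano)
    case (trans a b c)
    then show ?case unfolding P_def using glue by auto
  next
    case (local x)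
    then obtain \<delta> where "\<delta> > 0" and d: "\<And>s. 0 \<le> s \<Longrightarrow> s \<le> 1 \<Longrightarrow> \<bar>s - x\<bar> < \<delta> \<Longrightarrow>
      n (\<phi> s - \<phi> x - (s - x) *\<^sub>R w) \<le> c * \<bar>s - x\<bar>" using loc[OF local] by blast
    have "P a b" if ab: "a \<le> x" "x \<le> b" "b - a < \<delta>" for a b
      unfolding P_def
    proof
      assume I: "0 \<le> a \<and> a \<le> b \<and> b \<le> 1"
      have "n (?d a x) \<le> c * (x - a)" using d[of a] neg[of a x] ab I by auto
      moreover have "n (?d x b) \<le> c * (b - x)" using d[of b] ab I by auto
      ultimately show "n (?d a b) \<le> c * (b - a)" using glue ab I by auto
    qed
    then show ?case using \<open>\<delta> > 0\<close> by blast
  qed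
  then show ?thesis by (simp add: P_def)
qed

text \<open>
  Along a segment in level 1 an sc-differentiable map is an honestly differentiable curve in level 0,
  because \<open>\<bar>s v\<bar>\<^sub>1 = \<bar>s\<bar> \<bar>v\<bar>\<^sub>1\<close> turns the sc-limit into an ordinary one.
\<close>

lemma sc_mean_value:
  assumes F: "normed_scale F" and G: "normed_scale G"
    and y: "y \<in> level F 1" and v: "v \<in> level F 1"
    and seg: "\<And>t. 0 \<le> t \<Longrightarrow> t \<le> 1 \<Longrightarrow> y + t *\<^sub>R v \<in> V"
    and g: "g ` V \<subseteq> level G 0"
    and K: "\<And>z. z \<in> V \<inter> level F 1 \<Longrightarrow> has_sc_derivative F V G g z (K z)"
    and w: "w \<in> level G 0"
    and near: "\<And>t. 0 \<le> t \<Longrightarrow> t \<le> 1 \<Longrightarrow> lnorm G 0 (K (y + t *\<^sub>R v) v - w) \<le> c"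
  shows "lnorm G 0 (g (y + v) - g y - w) \<le> c"
proof (rule field_le_epsilon)
  fix e :: real assume "e > 0"
  let ?y = "\<lambda>t::real. y + t *\<^sub>R v"
  have yF: "?y t \<in> level F 1" for t using y v by (intro level_closed[OF F])
  have "lnorm G 0 (g (?y 1) - g (?y 0) - w) \<le> c + e"
  proof (rule norm_on_mean_value[OF norm_on_level[OF G]])
    show "g (?y t) \<in> level G 0" if "0 \<le> t" "t \<le> 1" for t using seg[OF that] g by auto
    show "w \<in> level G 0" by (rule w)
    fix t :: real assume t: "0 \<le> t" "t \<le> 1"
    have nv: "lnorm F 1 v \<ge> 0" by (rule lnorm_nonneg[OF F v])
    have z: "?y t \<in> V" "?y t \<in> V \<inter> level F 1" using seg[OF t] yF by auto
    have v0: "v \<in> level F 0" by (rule level_0[OF F v])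
    \<comment> \<open>The summand 1 covers \<open>v = 0\<close>.\<close>
    define e' where "e' = e / (lnorm F 1 v + 1)"
    have e': "e' > 0" "e' * lnorm F 1 v \<le> e"
      using \<open>e > 0\<close> nv by (auto simp: e'_def field_simps)
    obtain \<delta> where "\<delta> > 0" and lin: "linear_between (level F 0) (level G 0) (K (?y t))"
      and d: "\<And>h. h \<in> level F 1 \<Longrightarrow> ?y t + h \<in> V \<Longrightarrow> lnorm F 1 h < \<delta> \<Longrightarrow>
        lnorm G 0 (g (?y t + h) - g (?y t) - K (?y t) h) \<le> e' * lnorm F 1 h"
      using K[OF z(2)] e'(1) unfolding has_sc_derivative_iff_little_o[OF F G z(1) g] by blast
    define \<delta>' where "\<delta>' = \<delta> / (lnorm F 1 v + 1)"
    have "\<delta>' > 0" using \<open>\<delta> > 0\<close> nv by (simp add: \<delta>'_def)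
    have "lnorm G 0 (g (?y s) - g (?y t) - (s - t) *\<^sub>R w) \<le> (c + e) * \<bar>s - t\<bar>"
      if s: "0 \<le> s" "s \<le> 1" "\<bar>s - t\<bar> < \<delta>'" for s
    proof -
      let ?h = "(s - t) *\<^sub>R v"
      have eq: "?y t + ?h = ?y s" by (simp add: algebra_simps)
      have nh: "lnorm F 1 ?h = \<bar>s - t\<bar> * lnorm F 1 v" by (rule lnorm_scaleR[OF F v])
      have "\<bar>s - t\<bar> * lnorm F 1 v \<le> \<bar>s - t\<bar> * (lnorm F 1 v + 1)" by (intro mult_left_mono) auto
      also have "\<dots> < \<delta>" using s(3) nv by (simp add: \<delta>'_def field_simps)
      finally have "lnorm F 1 ?h < \<delta>" using nh by simp
      then have "lnorm G 0 (g (?y s) - g (?y t) - K (?y t) ?h) \<le> e' * (\<bar>s - t\<bar> * lnorm F 1 v)"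
        using d[of ?h] seg[OF s(1,2)] level_closed(4)[OF F v] eq nh by metis
      also have "\<dots> \<le> e * \<bar>s - t\<bar>"
        using mult_right_mono[OF e'(2), of "\<bar>s - t\<bar>"] by (simp add: mult_ac)
      finally have 1: "lnorm G 0 (g (?y s) - g (?y t) - K (?y t) ?h) \<le> e * \<bar>s - t\<bar>" .
      have Kv: "K (?y t) v \<in> level G 0" and Kh: "K (?y t) ?h = (s - t) *\<^sub>R K (?y t) v"
        using linear_betweenD[OF lin] v0 by auto
      have "lnorm G 0 ((s - t) *\<^sub>R (K (?y t) v - w)) \<le> \<bar>s - t\<bar> * c"
        unfolding lnorm_scaleR[OF G level_closed(3)[OF G Kv w]]
        using near[OF t] by (intro mult_left_mono) auto
      moreover have "lnorm G 0 ((g (?y s) - g (?y t) - K (?y t) ?h) + (s - t) *\<^sub>R (K (?y t) v - w))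
        \<le> lnorm G 0 (g (?y s) - g (?y t) - K (?y t) ?h) + lnorm G 0 ((s - t) *\<^sub>R (K (?y t) v - w))"
        unfolding Kh using g seg[OF s(1,2)] seg[OF t] Kv w
        by (intro lnorm_triangle[OF G] level_closed[OF G]) auto
      moreover have "(g (?y s) - g (?y t) - K (?y t) ?h) + (s - t) *\<^sub>R (K (?y t) v - w)
          = g (?y s) - g (?y t) - (s - t) *\<^sub>R w"
        unfolding Kh by (simp add: algebra_simps)
      ultimately show ?thesis using 1 by (simp add: algebra_simps)
    qed
    then show "\<exists>\<delta>>0. \<forall>s. 0 \<le> s \<and> s \<le> 1 \<and> \<bar>s - t\<bar> < \<delta> \<longrightarrow>
      lnorm G 0 (g (?y s) - g (?y t) - (s - t) *\<^sub>R w) \<le> (c + e) * \<bar>s - t\<bar>" using \<open>\<delta>' > 0\<close> by blast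
  qed
  then show "lnorm G 0 (g (y + v) - g y - w) \<le> c + e" by simp
qed

lemma sc0_T_with_continuous:
  assumes F: "normed_scale F" and G: "normed_scale G"
    and T: "sc0 (T_space F) (T_set F V) (T_space G) (T_set G W) (T_with g K)"
    and y: "y \<in> V \<inter> level F 1" and e: "e \<in> level F 0" and "\<epsilon> > 0"
  shows "\<exists>\<delta>>0. \<forall>z \<in> V \<inter> level F 1. \<forall>e' \<in> level F 0.
    lnorm F 1 (y - z) + lnorm F 0 (e - e') < \<delta> \<longrightarrow> lnorm G 0 (K y e - K z e') < \<epsilon>"
proof -
  note iff = sc0_iff[OF normed_scale_T_space[OF F] normed_scale_T_space[OF G]]
  have im: "(g z, K z e') \<in> level G 1 \<times> level G 0"
    if "z \<in> V \<inter> level F 1" "e' \<in> level F 0" for z e'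
    using T[unfolded iff, rule_format, of "(z, e')" 0] that by (auto simp: T_set_def T_with_def)
  have ye: "(y, e) \<in> T_set F V \<inter> level (T_space F) 0" using y e by (auto simp: T_set_def)
  obtain \<delta> where "\<delta> > 0" and d: "\<And>p. p \<in> T_set F V \<inter> level (T_space F) 0 \<Longrightarrow>
      lnorm (T_space F) 0 ((y, e) - p) < \<delta> \<Longrightarrow>
      lnorm (T_space G) 0 (T_with g K (y, e) - T_with g K p) < \<epsilon>"
    using T[unfolded iff, THEN spec, THEN bspec, OF ye] \<open>\<epsilon> > 0\<close> by blast
  have "lnorm G 0 (K y e - K z e') < \<epsilon>"
    if z: "z \<in> V \<inter> level F 1" and e': "e' \<in> level F 0"
      and l: "lnorm F 1 (y - z) + lnorm F 0 (e - e') < \<delta>" for z e'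
  proof -
    have "lnorm G 1 (g y - g z) + lnorm G 0 (K y e - K z e') < \<epsilon>"
      using d[of "(z, e')"] z e' l by (simp add: T_set_def T_with_def)
    moreover have "0 \<le> lnorm G 1 (g y - g z)"
      using im[OF y e] im[OF z e'] by (intro lnorm_nonneg[OF G] level_closed[OF G]) auto
    ultimately show ?thesis by simp
  qed
  then show ?thesis using \<open>\<delta> > 0\<close> by blast
qed

text \<open>
  Joint continuity of \<open>(z, e) \<mapsto> K z e\<close> at \<open>(y, 0)\<close> and linearity in \<open>e\<close> bound the operators \<open>K z\<close>
  uniformly for \<open>z\<close> near \<open>y\<close> in level 1.
\<close>

lemma tangent_locally_bounded:
  assumes F: "normed_scale F" and G: "normed_scale G"
    and T: "sc0 (T_space F) (T_set F V) (T_space G) (T_set G W) (T_with g K)"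
    and K: "\<And>z. z \<in> V \<inter> level F 1 \<Longrightarrow> linear_between (level F 0) (level G 0) (K z)"
    and y: "y \<in> V \<inter> level F 1"
  shows "\<exists>\<delta>>0. \<exists>M>0. \<forall>z \<in> V \<inter> level F 1. lnorm F 1 (y - z) < \<delta> \<longrightarrow>
    (\<forall>e \<in> level F 0. lnorm G 0 (K z e) \<le> M * lnorm F 0 e)"
proof -
  obtain \<delta> where "\<delta> > 0" and d: "\<And>z e. z \<in> V \<inter> level F 1 \<Longrightarrow> e \<in> level F 0 \<Longrightarrow>
      lnorm F 1 (y - z) + lnorm F 0 (0 - e) < \<delta> \<Longrightarrow> lnorm G 0 (K y 0 - K z e) < 1"
    using sc0_T_with_continuous[OF F G T y level_closed(1)[OF F] zero_less_one] by blast
  have K0: "K y 0 = 0"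
    using linear_betweenD(3)[OF K[OF y] level_closed(1)[OF F], of 0] by simp
  have "lnorm G 0 (K z e) \<le> 4 / \<delta> * lnorm F 0 e"
    if z: "z \<in> V \<inter> level F 1" "lnorm F 1 (y - z) < \<delta> / 2" and e: "e \<in> level F 0" for z e
  proof (cases "e = 0")
    case True
    have "K z 0 = 0"
      using linear_betweenD(3)[OF K[OF z(1)] level_closed(1)[OF F], of 0] by simp
    then show ?thesis using True by (simp add: lnorm_zero[OF F] lnorm_zero[OF G])
  next
    case False
    then have p: "0 < lnorm F 0 e" using lnorm_nonneg[OF F e] lnorm_eq_0[OF F e] by linarith
    \<comment> \<open>Negative, because the continuity estimate bounds differences from \<open>0\<close>.\<close>
    let ?c = "- (\<delta> / (4 * lnorm F 0 e))"
    have c0: "?c *\<^sub>R e \<in> level F 0" by (rule level_closed(4)[OF F e])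
    have "lnorm F 0 (0 - ?c *\<^sub>R e) = \<delta> / 4"
      using p \<open>\<delta> > 0\<close> lnorm_scaleR[OF F e, of "\<delta> / (4 * lnorm F 0 e)"] by simp
    then have "lnorm G 0 (K y 0 - K z (?c *\<^sub>R e)) < 1"
      using z(2) \<open>\<delta> > 0\<close> by (intro d[OF z(1) c0]) simp
    also have "K y 0 - K z (?c *\<^sub>R e) = (\<delta> / (4 * lnorm F 0 e)) *\<^sub>R K z e"
      using linear_betweenD(3)[OF K[OF z(1)] e, of ?c] K0 by simp
    also have "lnorm G 0 \<dots> = \<delta> / (4 * lnorm F 0 e) * lnorm G 0 (K z e)"
      using lnorm_scaleR[OF G linear_betweenD(1)[OF K[OF z(1)] e]] p \<open>\<delta> > 0\<close> by simp
    finally show ?thesis using p \<open>\<delta> > 0\<close> by (simp add: field_simps)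
  qed
  then show ?thesis
    using \<open>\<delta> > 0\<close> by (intro exI[of _ "\<delta> / 2"] conjI exI[of _ "4 / \<delta>"]) auto
qed

text \<open>
  The substitute for continuity of \<open>z \<mapsto> K z\<close> in operator norm. At the finitely many points of a net
  of the unit ball of \<open>E\<^sub>1\<close> the values of \<open>K z \<circ> L\<close> converge as \<open>z \<rightarrow> y\<close>; the uniform bound on \<open>K z\<close>
  carries this over to the whole ball, and homogeneity to all of \<open>E\<^sub>1\<close>.
\<close>

lemma tangent_uniformly_continuous_on_ball:
  assumes E: "sc_banach E" and F: "normed_scale F" and G: "normed_scale G"
    and T: "sc0 (T_space F) (T_set F V) (T_space G) (T_set G W) (T_with g K)"
    and K: "\<And>z. z \<in> V \<inter> level F 1 \<Longrightarrow> linear_between (level F 0) (level G 0) (K z)"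
    and y: "y \<in> V \<inter> level F 1"
    and L: "linear_between (level E 0) (level F 0) L"
    and bd: "\<exists>B. \<forall>h\<in>level E 0. lnorm F 0 (L h) \<le> B * lnorm E 0 h"
    and "\<epsilon> > 0"
  shows "\<exists>\<delta>>0. \<forall>z \<in> V \<inter> level F 1. lnorm F 1 (y - z) < \<delta> \<longrightarrow>
    (\<forall>h \<in> level E 1. lnorm G 0 (K z (L h) - K y (L h)) \<le> \<epsilon> * lnorm E 1 h)"
proof -
  note nE = sc_banach_normed_scale[OF E]
  obtain \<delta>\<^sub>0 M where "\<delta>\<^sub>0 > 0" "M > 0" and M: "\<And>z e. z \<in> V \<inter> level F 1 \<Longrightarrow> lnorm F 1 (y - z) < \<delta>\<^sub>0 \<Longrightarrow>
      e \<in> level F 0 \<Longrightarrow> lnorm G 0 (K z e) \<le> M * lnorm F 0 e"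
    using tangent_locally_bounded[OF F G T K y] by blast
  obtain B where "B > 0" and B: "\<And>h. h \<in> level E 0 \<Longrightarrow> lnorm F 0 (L h) \<le> B * lnorm E 0 h"
    using positive_bound[OF nE bd] by blast
  \<comment> \<open>Moving \<open>h\<close> by \<open>\<eta>\<close> moves \<open>K z (L h)\<close> by at most \<open>\<epsilon> / 4\<close>; this happens once at \<open>z\<close> and once at \<open>y\<close>.\<close>
  define \<eta> where "\<eta> = \<epsilon> / (4 * M * B)"
  have "\<eta> > 0" and \<eta>: "M * (B * \<eta>) = \<epsilon> / 4"
    using \<open>\<epsilon> > 0\<close> \<open>M > 0\<close> \<open>B > 0\<close> by (simp_all add: \<eta>_def)
  obtain A where A: "finite A" "A \<subseteq> level E 0"
    and net: "\<And>h. h \<in> level E 1 \<Longrightarrow> lnorm E 1 h \<le> 1 \<Longrightarrow> \<exists>a\<in>A. lnorm E 0 (h - a) < \<eta>"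
    using finite_net_of_unit_ball[OF E \<open>\<eta> > 0\<close>] by blast
  have L0: "L h \<in> level F 0" if "h \<in> level E 0" for h using linear_betweenD(1)[OF L that] .
  have "\<exists>\<delta>>0. \<forall>z \<in> V \<inter> level F 1. lnorm F 1 (y - z) < \<delta> \<longrightarrow>
      lnorm G 0 (K y (L a) - K z (L a)) < \<epsilon> / 2" if a: "a \<in> A" for a
  proof -
    have a0: "L a \<in> level F 0" using a A L0 by blast
    obtain \<delta> where "\<delta> > 0" and d: "\<And>z e'. z \<in> V \<inter> level F 1 \<Longrightarrow> e' \<in> level F 0 \<Longrightarrow>
        lnorm F 1 (y - z) + lnorm F 0 (L a - e') < \<delta> \<Longrightarrow> lnorm G 0 (K y (L a) - K z e') < \<epsilon> / 2"
      using sc0_T_with_continuous[OF F G T y a0, of "\<epsilon> / 2"] \<open>\<epsilon> > 0\<close> by auto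
    have "lnorm G 0 (K y (L a) - K z (L a)) < \<epsilon> / 2"
      if "z \<in> V \<inter> level F 1" "lnorm F 1 (y - z) < \<delta>" for z
      using d[OF that(1) a0] that(2) by (simp add: lnorm_zero[OF F])
    then show ?thesis using \<open>\<delta> > 0\<close> by blast
  qed
  then have "\<exists>d. \<forall>a\<in>A. d a > 0 \<and> (\<forall>z \<in> V \<inter> level F 1. lnorm F 1 (y - z) < d a \<longrightarrow>
      lnorm G 0 (K y (L a) - K z (L a)) < \<epsilon> / 2)"
    by (intro bchoice) blast
  then obtain d where d0: "\<And>a. a \<in> A \<Longrightarrow> d a > 0"
    and d: "\<And>a z. a \<in> A \<Longrightarrow> z \<in> V \<inter> level F 1 \<Longrightarrow> lnorm F 1 (y - z) < d a \<Longrightarrow>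
      lnorm G 0 (K y (L a) - K z (L a)) < \<epsilon> / 2"
    by blast
  define \<delta> where "\<delta> = Min (insert \<delta>\<^sub>0 (d ` A))"
  have \<delta>: "\<delta> > 0" "\<delta> \<le> \<delta>\<^sub>0" "\<And>a. a \<in> A \<Longrightarrow> \<delta> \<le> d a"
    using A(1) \<open>\<delta>\<^sub>0 > 0\<close> d0 by (auto simp: \<delta>_def)
  have "lnorm G 0 (K z (L h) - K y (L h)) \<le> \<epsilon> * lnorm E 1 h"
    if z: "z \<in> V \<inter> level F 1" "lnorm F 1 (y - z) < \<delta>" and h: "h \<in> level E 1" for z h
  proof -
    have K0: "K z' (L k) \<in> level G 0" if "z' \<in> V \<inter> level F 1" "k \<in> level E 0" for z' k
      using linear_betweenD(1)[OF K[OF that(1)] L0[OF that(2)]] .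
    have unit: "lnorm G 0 (K z (L k) - K y (L k)) \<le> \<epsilon>" if k: "k \<in> level E 1" "lnorm E 1 k \<le> 1" for k
    proof -
      obtain a where a: "a \<in> A" "lnorm E 0 (k - a) < \<eta>" using net[OF k] by blast
      have lev: "k \<in> level E 0" "a \<in> level E 0" "k - a \<in> level E 0"
        using level_0[OF nE k(1)] a A by (auto intro: level_closed[OF nE])
      have small: "lnorm G 0 (K z' (L (k - a))) \<le> \<epsilon> / 4"
        if z': "z' \<in> V \<inter> level F 1" "lnorm F 1 (y - z') < \<delta>\<^sub>0" for z'
      proof -
        have "lnorm G 0 (K z' (L (k - a))) \<le> M * lnorm F 0 (L (k - a))"
          by (rule M[OF z' L0[OF lev(3)]])
        also have "\<dots> \<le> M * (B * lnorm E 0 (k - a))"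
          using B[OF lev(3)] \<open>M > 0\<close> by simp
        also have "\<dots> \<le> M * (B * \<eta>)" using a(2) \<open>M > 0\<close> \<open>B > 0\<close> by simp
        finally show ?thesis using \<eta> by simp
      qed
      have split: "K z' (L k) = K z' (L (k - a)) + K z' (L a)" if "z' \<in> V \<inter> level F 1" for z'
      proof -
        have "L k = L (k - a) + L a" using linear_betweenD(2)[OF L lev(3,2)] by simp
        then show ?thesis using linear_betweenD(2)[OF K[OF that] L0[OF lev(3)] L0[OF lev(2)]] by simp
      qed
      have "K z (L k) - K y (L k)
          = (K z (L (k - a)) - K y (L (k - a))) - (K y (L a) - K z (L a))"
        unfolding split[OF z(1)] split[OF y] by simp
      also have "lnorm G 0 \<dots> \<le> lnorm G 0 (K z (L (k - a)) - K y (L (k - a)))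
          + lnorm G 0 (K y (L a) - K z (L a))"
        using K0[OF z(1)] K0[OF y] lev by (intro lnorm_triangle_diff[OF G] level_closed[OF G]) auto
      also have "lnorm G 0 (K z (L (k - a)) - K y (L (k - a)))
          \<le> lnorm G 0 (K z (L (k - a))) + lnorm G 0 (K y (L (k - a)))"
        using K0[OF z(1)] K0[OF y] lev by (intro lnorm_triangle_diff[OF G]) auto
      also have "lnorm G 0 (K z (L (k - a))) \<le> \<epsilon> / 4" using small z \<delta>(2) by simp
      also have "lnorm G 0 (K y (L (k - a))) \<le> \<epsilon> / 4"
        using small[OF y] \<open>\<delta>\<^sub>0 > 0\<close> by (simp add: lnorm_zero[OF F])
      also have "lnorm G 0 (K y (L a) - K z (L a)) \<le> \<epsilon> / 2"
        using d[OF a(1) z(1)] z(2) \<delta>(3)[OF a(1)] by simp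
      finally show ?thesis by simp
    qed
    show ?thesis
    proof (cases "h = 0")
      case True
      have "L 0 = 0"
        using linear_betweenD(3)[OF L level_closed(1)[OF nE], of 0] by simp
      moreover have "K z 0 = 0" "K y 0 = 0"
        using linear_betweenD(3)[OF K[OF z(1)] level_closed(1)[OF F], of 0]
          linear_betweenD(3)[OF K[OF y] level_closed(1)[OF F], of 0] by simp_all
      ultimately show ?thesis using True by (simp add: lnorm_zero[OF nE] lnorm_zero[OF G])
    next
      case False
      then have p: "0 < lnorm E 1 h" using lnorm_nonneg[OF nE h] lnorm_eq_0[OF nE h] by linarith
      let ?c = "1 / lnorm E 1 h"
      have h0: "h \<in> level E 0" by (rule level_0[OF nE h])
      have sc: "K z' (L (?c *\<^sub>R h)) = ?c *\<^sub>R K z' (L h)" if "z' \<in> V \<inter> level F 1" for z'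
        using linear_betweenD(3)[OF L h0] linear_betweenD(3)[OF K[OF that] L0[OF h0]] by simp
      have "lnorm G 0 (K z (L (?c *\<^sub>R h)) - K y (L (?c *\<^sub>R h))) \<le> \<epsilon>"
        using h p by (intro unit level_closed[OF nE]) (simp_all add: lnorm_scaleR[OF nE])
      also have "K z (L (?c *\<^sub>R h)) - K y (L (?c *\<^sub>R h)) = ?c *\<^sub>R (K z (L h) - K y (L h))"
        unfolding sc[OF z(1)] sc[OF y] by (simp add: scaleR_diff_right)
      also have "lnorm G 0 \<dots> = ?c * lnorm G 0 (K z (L h) - K y (L h))"
        using lnorm_scaleR[OF G level_closed(3)[OF G K0[OF z(1) h0] K0[OF y h0]]] p by simp
      finally show ?thesis using p by (simp add: field_simps)
    qed
  qed
  then show ?thesis using \<delta>(1) by blast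
qed

text \<open>
  Split \<open>v = f (x + h) - f x\<close> as \<open>L h + e\<close>. For \<open>z\<close> on the segment from \<open>f x\<close> to \<open>f (x + h)\<close>,
  \<open>K z v - K (f x) (L h) = (K z - K (f x)) (L h) + K z e\<close>, where the first term is small by uniformity on
  the ball and the second because \<open>K z\<close> is locally bounded. The mean value inequality then compares
  \<open>g (f (x + h)) - g (f x)\<close> with \<open>K (f x) (L h)\<close>. The hypothesis on segments replaces convexity of \<open>V\<close>.
\<close>

lemma chain_rule_derivative:
  assumes E: "sc_banach E" and F: "normed_scale F" and G: "normed_scale G"
    and U: "U \<subseteq> level E 0" and V: "V \<subseteq> level F 0"
    and seg: "\<And>y. y \<in> V \<Longrightarrow> \<exists>\<delta>>0. \<forall>z\<in>V. lnorm F 0 (y - z) < \<delta> \<longrightarrow>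
      (\<forall>t. 0 \<le> t \<and> t \<le> 1 \<longrightarrow> y + t *\<^sub>R (z - y) \<in> V)"
    and f: "sc0 E U F V f" and x: "x \<in> U \<inter> level E 1" and L: "has_sc_derivative E U F f x L"
    and g: "sc0 F V G W g" and K: "\<And>z. z \<in> V \<inter> level F 1 \<Longrightarrow> has_sc_derivative F V G g z (K z)"
    and T: "sc0 (T_space F) (T_set F V) (T_space G) (T_set G W) (T_with g K)"
  shows "has_sc_derivative E U G (g \<circ> f) x (K (f x) \<circ> L)"
proof -
  note nE = sc_banach_normed_scale[OF E]
  have xU: "x \<in> U" using x by blast
  note f0 = sc0_image[OF nE F U f] and g0 = sc0_image[OF F G V g]
  have fV: "f ` U \<subseteq> V" using f[unfolded sc0_iff[OF nE F], THEN spec, of 0] U by auto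
  have y: "f x \<in> V \<inter> level F 1" using f[unfolded sc0_iff[OF nE F]] x by blast
  have lin: "linear_between (level E 0) (level F 0) L"
    and bd: "\<exists>B. \<forall>h\<in>level E 0. lnorm F 0 (L h) \<le> B * lnorm E 0 h"
    and o: "\<And>\<epsilon>. \<epsilon> > 0 \<Longrightarrow> \<exists>\<delta>>0. \<forall>h \<in> level E 1. x + h \<in> U \<and> lnorm E 1 h < \<delta> \<longrightarrow>
        lnorm F 0 (f (x + h) - f x - L h) \<le> \<epsilon> * lnorm E 1 h"
    using L unfolding has_sc_derivative_iff_little_o[OF nE F xU f0] by blast+
  have linK: "linear_between (level F 0) (level G 0) (K z)" if "z \<in> V \<inter> level F 1" for z
    using K[OF that] by (simp add: has_sc_derivative_def)
  have K_bd: "\<exists>B. \<forall>e\<in>level F 0. lnorm G 0 (K (f x) e) \<le> B * lnorm F 0 e"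
    using K[OF y] by (simp add: has_sc_derivative_def)
  have L0: "L h \<in> level F 0" if "h \<in> level E 0" for h using linear_betweenD(1)[OF lin that] .
  have lin': "linear_between (level E 0) (level G 0) (K (f x) \<circ> L)"
    using lin linK[OF y] unfolding linear_between_def by (auto simp: image_subset_iff)
  have bd': "\<exists>B. \<forall>h\<in>level E 0. lnorm G 0 ((K (f x) \<circ> L) h) \<le> B * lnorm E 0 h"
  proof -
    obtain A where "A > 0" and A: "\<forall>e\<in>level F 0. lnorm G 0 (K (f x) e) \<le> A * lnorm F 0 e"
      using positive_bound[OF F K_bd] by blast
    obtain B where B: "\<forall>h\<in>level E 0. lnorm F 0 (L h) \<le> B * lnorm E 0 h" using bd by blast
    have "lnorm G 0 (K (f x) (L h)) \<le> A * B * lnorm E 0 h" if h: "h \<in> level E 0" for h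
    proof -
      have "lnorm G 0 (K (f x) (L h)) \<le> A * lnorm F 0 (L h)" using A L0[OF h] by blast
      also have "\<dots> \<le> A * (B * lnorm E 0 h)" using B h \<open>A > 0\<close> by simp
      finally show ?thesis by simp
    qed
    then show ?thesis by auto
  qed
  have "\<exists>\<delta>>0. \<forall>h \<in> level E 1. x + h \<in> U \<and> lnorm E 1 h < \<delta> \<longrightarrow>
      lnorm G 0 ((g \<circ> f) (x + h) - (g \<circ> f) x - (K (f x) \<circ> L) h) \<le> \<epsilon> * lnorm E 1 h"
    if "\<epsilon> > 0" for \<epsilon>
  proof -
    obtain \<delta>\<^sub>1 M where "\<delta>\<^sub>1 > 0" "M > 0" and M: "\<And>z e. z \<in> V \<inter> level F 1 \<Longrightarrow>
        lnorm F 1 (f x - z) < \<delta>\<^sub>1 \<Longrightarrow> e \<in> level F 0 \<Longrightarrow> lnorm G 0 (K z e) \<le> M * lnorm F 0 e"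
      using tangent_locally_bounded[OF F G T linK y] by blast
    obtain \<delta>\<^sub>2 where "\<delta>\<^sub>2 > 0" and d2: "\<And>z h. z \<in> V \<inter> level F 1 \<Longrightarrow> lnorm F 1 (f x - z) < \<delta>\<^sub>2 \<Longrightarrow>
        h \<in> level E 1 \<Longrightarrow> lnorm G 0 (K z (L h) - K (f x) (L h)) \<le> \<epsilon> / 2 * lnorm E 1 h"
      using tangent_uniformly_continuous_on_ball[OF E F G T linK y lin bd, of "\<epsilon> / 2"] \<open>\<epsilon> > 0\<close> by auto
    define \<epsilon>' where "\<epsilon>' = \<epsilon> / (2 * M)"
    have "\<epsilon>' > 0" and \<epsilon>': "M * \<epsilon>' = \<epsilon> / 2" using \<open>\<epsilon> > 0\<close> \<open>M > 0\<close> by (simp_all add: \<epsilon>'_def)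
    obtain \<delta>\<^sub>3 where "\<delta>\<^sub>3 > 0" and d3: "\<And>h. h \<in> level E 1 \<Longrightarrow> x + h \<in> U \<Longrightarrow> lnorm E 1 h < \<delta>\<^sub>3 \<Longrightarrow>
        lnorm F 0 (f (x + h) - f x - L h) \<le> \<epsilon>' * lnorm E 1 h"
      using o[OF \<open>\<epsilon>' > 0\<close>] by blast
    have "min \<delta>\<^sub>1 \<delta>\<^sub>2 > 0" using \<open>\<delta>\<^sub>1 > 0\<close> \<open>\<delta>\<^sub>2 > 0\<close> by simp
    then obtain \<delta>\<^sub>4 where "\<delta>\<^sub>4 > 0" and d4: "\<And>x'. x' \<in> U \<inter> level E 1 \<Longrightarrow> lnorm E 1 (x - x') < \<delta>\<^sub>4 \<Longrightarrow>
        lnorm F 1 (f x - f x') < min \<delta>\<^sub>1 \<delta>\<^sub>2"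
      using f[unfolded sc0_iff[OF nE F]] x by blast
    obtain \<delta>\<^sub>5 where "\<delta>\<^sub>5 > 0" and d5: "\<And>z t. z \<in> V \<Longrightarrow> lnorm F 0 (f x - z) < \<delta>\<^sub>5 \<Longrightarrow> 0 \<le> t \<Longrightarrow> t \<le> 1 \<Longrightarrow>
        f x + t *\<^sub>R (z - f x) \<in> V"
      using seg[of "f x"] y by blast
    have x0: "x \<in> U \<inter> level E 0" using x level_0[OF nE] by blast
    obtain \<delta>\<^sub>6 where "\<delta>\<^sub>6 > 0" and d6: "\<And>x'. x' \<in> U \<inter> level E 0 \<Longrightarrow> lnorm E 0 (x - x') < \<delta>\<^sub>6 \<Longrightarrow>
        lnorm F 0 (f x - f x') < \<delta>\<^sub>5"
      using f[unfolded sc0_iff[OF nE F]] x0 \<open>\<delta>\<^sub>5 > 0\<close> by blast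
    obtain B where "B > 0" and B: "\<And>h. h \<in> level E 1 \<Longrightarrow> lnorm E 0 h \<le> B * lnorm E 1 h"
      using level_inclusion_bounded[OF E] by blast
    define \<delta> where "\<delta> = min \<delta>\<^sub>3 (min \<delta>\<^sub>4 (\<delta>\<^sub>6 / B))"
    have "\<delta> > 0" using \<open>\<delta>\<^sub>3 > 0\<close> \<open>\<delta>\<^sub>4 > 0\<close> \<open>\<delta>\<^sub>6 > 0\<close> \<open>B > 0\<close> by (simp add: \<delta>_def)
    have "lnorm G 0 (g (f (x + h)) - g (f x) - K (f x) (L h)) \<le> \<epsilon> * lnorm E 1 h"
      if h: "h \<in> level E 1" "x + h \<in> U" "lnorm E 1 h < \<delta>" for h
    proof -
      have h0: "h \<in> level E 0" by (rule level_0[OF nE h(1)])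
      have xh1: "x + h \<in> U \<inter> level E 1" using h x level_closed(2)[OF nE] by auto
      then have xh0: "x + h \<in> U \<inter> level E 0" using level_0[OF nE] by blast
      have yh: "f (x + h) \<in> V \<inter> level F 1" using f[unfolded sc0_iff[OF nE F]] xh1 by blast
      have neg: "lnorm E m (x - (x + h)) = lnorm E m h" if "h \<in> level E m" for m
        using lnorm_scaleR[OF nE that, of "-1"] by simp
      let ?v = "f (x + h) - f x" and ?e = "f (x + h) - f x - L h"
      have v: "?v \<in> level F 1" using y yh level_closed(3)[OF F] by blast
      have v0: "?v \<in> level F 0" by (rule level_0[OF F v])
      have e0: "?e \<in> level F 0" by (rule level_closed(3)[OF F v0 L0[OF h0]])
      have nv: "lnorm F 1 (f x - f (x + h)) < min \<delta>\<^sub>1 \<delta>\<^sub>2"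
        using h(3) neg[OF h(1)] by (intro d4[OF xh1]) (simp add: \<delta>_def)
      have ne: "lnorm F 0 ?e \<le> \<epsilon>' * lnorm E 1 h" using h by (intro d3) (simp_all add: \<delta>_def)
      have "lnorm E 0 h < \<delta>\<^sub>6"
        using B[OF h(1)] h(3) \<open>B > 0\<close> by (simp add: \<delta>_def field_simps)
      then have close: "lnorm F 0 (f x - f (x + h)) < \<delta>\<^sub>5" using neg[OF h0] by (intro d6[OF xh0]) simp
      have seg': "f x + t *\<^sub>R ?v \<in> V" if "0 \<le> t" "t \<le> 1" for t
        using d5[OF _ close that] yh by blast
      have "lnorm G 0 (g (f x + ?v) - g (f x) - K (f x) (L h)) \<le> \<epsilon> * lnorm E 1 h"
      proof (rule sc_mean_value[OF F G _ v seg' g0 K])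
        show "f x \<in> level F 1" using y by blast
        show "K (f x) (L h) \<in> level G 0" using linear_betweenD(1)[OF linK[OF y] L0[OF h0]] .
        fix t :: real assume t: "0 \<le> t" "t \<le> 1"
        let ?z = "f x + t *\<^sub>R ?v"
        have z: "?z \<in> V \<inter> level F 1"
          using seg'[OF t] y v level_closed(2)[OF F _ level_closed(4)[OF F v]] by blast
        have "f x - ?z = t *\<^sub>R (f x - f (x + h))" by (simp add: algebra_simps)
        also have "lnorm F 1 \<dots> = \<bar>t\<bar> * lnorm F 1 (f x - f (x + h))"
          using y yh level_closed(3)[OF F] by (intro lnorm_scaleR[OF F]) blast
        also have "\<dots> \<le> 1 * lnorm F 1 (f x - f (x + h))"
          using t y yh level_closed(3)[OF F] by (intro mult_right_mono lnorm_nonneg[OF F]) auto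
        also have "\<dots> < min \<delta>\<^sub>1 \<delta>\<^sub>2" using nv by simp
        finally have near: "lnorm F 1 (f x - ?z) < \<delta>\<^sub>1" "lnorm F 1 (f x - ?z) < \<delta>\<^sub>2" by simp_all
        note K0 = linear_betweenD(1)[OF linK[OF z]]
        have "L h + ?e = ?v" by simp
        then have "K ?z ?v = K ?z (L h) + K ?z ?e"
          using linear_betweenD(2)[OF linK[OF z] L0[OF h0] e0] by metis
        then have "K ?z ?v - K (f x) (L h) = (K ?z (L h) - K (f x) (L h)) + K ?z ?e" by simp
        also have "lnorm G 0 \<dots> \<le> lnorm G 0 (K ?z (L h) - K (f x) (L h)) + lnorm G 0 (K ?z ?e)"
          using K0 e0 L0[OF h0] linear_betweenD(1)[OF linK[OF y]]
          by (intro lnorm_triangle[OF G] level_closed(3)[OF G]) auto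
        also have "lnorm G 0 (K ?z (L h) - K (f x) (L h)) \<le> \<epsilon> / 2 * lnorm E 1 h"
          by (rule d2[OF z near(2) h(1)])
        also have "lnorm G 0 (K ?z ?e) \<le> M * lnorm F 0 ?e" by (rule M[OF z near(1) e0])
        also have "\<dots> \<le> M * (\<epsilon>' * lnorm E 1 h)" using ne \<open>M > 0\<close> by simp
        also have "\<dots> = \<epsilon> / 2 * lnorm E 1 h" using \<epsilon>' by (metis mult.assoc)
        finally show "lnorm G 0 (K ?z ?v - K (f x) (L h)) \<le> \<epsilon> * lnorm E 1 h" by simp
      qed
      then show ?thesis by simp
    qed
    then show ?thesis using \<open>\<delta> > 0\<close> by auto
  qed
  moreover have "(g \<circ> f) ` U \<subseteq> level G 0" using fV g0 by auto
  ultimately show ?thesis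
    using lin' bd' has_sc_derivative_iff_little_o[OF nE G xU] by blast
qed

section \<open>Uniqueness of the sc-derivative\<close>

lemma normed_scale_Rk: "normed_scale (sc_Rk k)"
proof -
  have "subspace {r :: real fin_seq. Poly_Mapping.keys r \<subseteq> {..<k}}"
    by (auto simp: subspace_def in_keys_iff lookup_add lookup_scaleR subset_iff)
       (metis add.right_neutral)
  then show ?thesis by (auto simp: normed_scale_def sc_Rk_def norm_on_def norm_triangle_ineq)
qed

lemma normed_scale_sc_sum:
  assumes "normed_scale E" "normed_scale F" shows "normed_scale (sc_sum E F)"
proof -
  have "norm_on (level E m \<times> level F m) (\<lambda>(x, y). lnorm E m x + lnorm F m y)" for m
    using norm_on_level[OF assms(1), of m] norm_on_level[OF assms(2), of m]
    unfolding norm_on_def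
    by (auto simp: subspace_Times zero_prod_def add_nonneg_eq_0_iff distrib_left intro: add_mono)
       (smt (verit))+
  moreover have "level E (Suc m) \<times> level F (Suc m) \<subseteq> level E m \<times> level F m" for m
    using assms by (auto simp: normed_scale_def)
  ultimately show ?thesis by (auto simp: normed_scale_def sc_sum_def)
qed

text \<open>
  The properties of a quadrant chart that are used: the coordinates \<open>q\<close> on the \<open>\<real>\<^sup>k\<close>-factor cut out \<open>C\<close>
  by inequalities, and the vector \<open>(1, \<dots>, 1, 0)\<close> of \<open>\<real>\<^sup>k \<oplus> W\<close> comes from a point \<open>u\<close> of level 1, since the
  inverse of the chart respects the levels.
\<close>

lemma partial_quadrant_coordinates:
  assumes E: "normed_scale E" and C: "partial_quadrant E C"
  shows "\<exists>k (q :: 'a::real_vector \<Rightarrow> real fin_seq) u.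
    C \<subseteq> level E 0 \<and> linear_between (level E 0) UNIV q \<and>
    (\<forall>x \<in> level E 0. x \<in> C \<longleftrightarrow> (\<forall>i<k. 0 \<le> Poly_Mapping.lookup (q x) i)) \<and>
    u \<in> level E 1 \<and> (\<forall>i<k. Poly_Mapping.lookup (q u) i = 1)"
proof -
  obtain k W T where ch: "quadrant_chart E C k W T" and cl: "closedin (level_top E 0) C"
    using C by (auto simp: partial_quadrant_def)
  let ?S = "sc_sum (sc_Rk k) W"
  have W: "normed_scale W" and iso: "sc_iso E ?S T" and TC: "T ` C = {(r, w). r \<in> level (sc_Rk k) 0 \<and>
      (\<forall>i<k. 0 \<le> Poly_Mapping.lookup r i) \<and> w \<in> level W 0}"
    using ch sc_banach_normed_scale by (auto simp: quadrant_chart_def)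
  have lev: "level ?S m = level (sc_Rk k) m \<times> level W m" for m by (simp add: sc_sum_def)
  have C0: "C \<subseteq> level E 0" using closedin_subset[OF cl] E by simp
  have bij: "bij_betw T (level E 0) (level ?S 0)" and lin: "linear_between (level E 0) (level ?S 0) T"
    and inv: "sc_operator ?S E (inv_into (level E 0) T)"
    using iso by (auto simp: sc_iso_def sc_operator_def)
  have mem: "x \<in> C \<longleftrightarrow> (\<forall>i<k. 0 \<le> Poly_Mapping.lookup (fst (T x)) i)" if x: "x \<in> level E 0" for x
  proof -
    have "T x \<in> level ?S 0" using linear_betweenD(1)[OF lin x] .
    then have "T x \<in> T ` C \<longleftrightarrow> (\<forall>i<k. 0 \<le> Poly_Mapping.lookup (fst (T x)) i)"
      unfolding TC lev by (auto simp: case_prod_beta)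
    moreover have "T x \<in> T ` C \<longleftrightarrow> x \<in> C"
      using inj_on_image_mem_iff[OF bij_betw_imp_inj_on[OF bij] x C0] .
    ultimately show ?thesis by blast
  qed
  \<comment> \<open>The point \<open>(1, \<dots>, 1)\<close> of \<open>\<real>\<^sup>k\<close>.\<close>
  define e :: "real fin_seq" where "e = (\<Sum>i<k. Poly_Mapping.single i 1)"
  have le: "Poly_Mapping.lookup e i = (if i < k then 1 else 0)" for i
    by (simp add: e_def lookup_sum lookup_single when_def)
  define u where "u = inv_into (level E 0) T (e, 0)"
  have eS: "(e, 0) \<in> level ?S m" for m
    using level_closed(1)[OF W] unfolding lev by (auto simp: sc_Rk_def in_keys_iff le split: if_splits)
  have "continuous_map (level_top ?S 1) (level_top E 1) (inv_into (level E 0) T)"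
    using inv by (simp add: sc_operator_def)
  then have "inv_into (level E 0) T ` level ?S 1 \<subseteq> level E 1"
    using continuous_map_image_subset_topspace E normed_scale_sc_sum[OF normed_scale_Rk W]
    by fastforce
  then have u: "u \<in> level E 1" using eS by (auto simp: u_def)
  have "T u = (e, 0)" using bij eS[of 0] by (simp add: u_def bij_betw_inv_into_right)
  then have "\<forall>i<k. Poly_Mapping.lookup (fst (T u)) i = 1" by (simp add: le)
  moreover have "linear_between (level E 0) UNIV (fst \<circ> T)" using lin by (simp add: linear_between_def)
  ultimately show ?thesis using C0 mem u by (intro exI[of _ k] exI[of _ "fst \<circ> T"] exI[of _ u]) simp
qed

lemma partial_quadrant_cone:
  assumes E: "normed_scale E" and C: "partial_quadrant E C"
  shows "C \<subseteq> level E 0" "x \<in> C \<Longrightarrow> y \<in> C \<Longrightarrow> x + y \<in> C" "x \<in> C \<Longrightarrow> 0 \<le> c \<Longrightarrow> c *\<^sub>R x \<in> C"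
proof -
  obtain k and q :: "_ \<Rightarrow> real fin_seq" where C0: "C \<subseteq> level E 0" and lin: "linear_between (level E 0) UNIV q"
    and mem': "\<forall>x \<in> level E 0. x \<in> C \<longleftrightarrow> (\<forall>i<k. 0 \<le> Poly_Mapping.lookup (q x) i)"
    using partial_quadrant_coordinates[OF E C] by blast
  note mem = bspec[OF mem']
  show "C \<subseteq> level E 0" by (rule C0)
  show "x + y \<in> C" if "x \<in> C" "y \<in> C"
  proof -
    have "x \<in> level E 0" "y \<in> level E 0" using that C0 by auto
    then show ?thesis
      using that linear_betweenD(2)[OF lin] mem level_closed(2)[OF E] by (simp add: lookup_add)
  qed
  show "c *\<^sub>R x \<in> C" if "x \<in> C" "0 \<le> c"
  proof -
    have "x \<in> level E 0" using that C0 by auto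
    then show ?thesis
      using that linear_betweenD(3)[OF lin] mem level_closed(4)[OF E] by (simp add: lookup_scaleR)
  qed
qed

text \<open>
  A large multiple of a level-1 point with all coordinates equal to 1 pushes \<open>h\<close> into the quadrant,
  so every \<open>h\<close> in level 1 is a difference of two level-1 points of \<open>C\<close>.
\<close>

lemma partial_quadrant_spans_level_1:
  assumes E: "normed_scale E" and C: "partial_quadrant E C" and h: "h \<in> level E 1"
  shows "\<exists>u \<in> C \<inter> level E 1. h + u \<in> C"
proof -
  obtain k and q :: "_ \<Rightarrow> real fin_seq" and u where lin: "linear_between (level E 0) UNIV q"
    and mem': "\<forall>x \<in> level E 0. x \<in> C \<longleftrightarrow> (\<forall>i<k. 0 \<le> Poly_Mapping.lookup (q x) i)"
    and u: "u \<in> level E 1" and one: "\<forall>i<k. Poly_Mapping.lookup (q u) i = 1"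
    using partial_quadrant_coordinates[OF E C] by blast
  note mem = bspec[OF mem']
  have h0: "h \<in> level E 0" and u0: "u \<in> level E 0" using h u level_0[OF E] by auto
  define c where "c = (\<Sum>i<k. \<bar>Poly_Mapping.lookup (q h) i\<bar>)"
  have c: "\<bar>Poly_Mapping.lookup (q h) i\<bar> \<le> c" if "i < k" for i
    unfolding c_def using that by (intro member_le_sum) auto
  have "0 \<le> c" by (simp add: c_def sum_nonneg)
  have qu: "Poly_Mapping.lookup (q (c *\<^sub>R u)) i = c" if "i < k" for i
    using linear_betweenD(3)[OF lin u0] one that by (simp add: lookup_scaleR)
  have cu0: "c *\<^sub>R u \<in> level E 0" by (rule level_closed(4)[OF E u0])
  have "c *\<^sub>R u \<in> C" using mem[OF cu0] qu \<open>0 \<le> c\<close> by simp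
  moreover have "0 \<le> Poly_Mapping.lookup (q (h + c *\<^sub>R u)) i" if "i < k" for i
    using linear_betweenD(2)[OF lin h0 cu0] qu[OF that] c[OF that] by (simp add: lookup_add)
  then have "h + c *\<^sub>R u \<in> C" using mem[OF level_closed(2)[OF E h0 cu0]] by simp
  ultimately show ?thesis using level_closed(4)[OF E u] by blast
qed

lemma relatively_open_locally_convex:
  assumes E: "normed_scale E" and C: "partial_quadrant E C"
    and U: "openin (subtopology (level_top E 0) C) U" and x: "x \<in> U"
  shows "\<exists>\<delta>>0. \<forall>y\<in>U. lnorm E 0 (x - y) < \<delta> \<longrightarrow> (\<forall>t. 0 \<le> t \<and> t \<le> 1 \<longrightarrow> x + t *\<^sub>R (y - x) \<in> U)"
proof -
  note cone = partial_quadrant_cone[OF E C]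
  have UC: "U \<subseteq> C" using openin_subset[OF U] by auto
  obtain \<delta> where "\<delta> > 0" and d: "\<And>y. y \<in> C \<Longrightarrow> lnorm E 0 (x - y) < \<delta> \<Longrightarrow> y \<in> U"
    using openin_level_ball[OF E cone(1) U x] by blast
  have "x + t *\<^sub>R (y - x) \<in> U" if y: "y \<in> U" "lnorm E 0 (x - y) < \<delta>" and t: "0 \<le> t" "t \<le> 1" for y t
  proof (rule d)
    have xy: "x \<in> C" "y \<in> C" using x y UC by auto
    have "(1 - t) *\<^sub>R x + t *\<^sub>R y \<in> C" using xy t by (intro cone(2,3)) auto
    then show "x + t *\<^sub>R (y - x) \<in> C" by (simp add: algebra_simps)
    have dl: "x - y \<in> level E 0" using xy cone(1) level_closed(3)[OF E] by blast
    have "x - (x + t *\<^sub>R (y - x)) = t *\<^sub>R (x - y)" by (simp add: algebra_simps)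
    then have "lnorm E 0 (x - (x + t *\<^sub>R (y - x))) = t * lnorm E 0 (x - y)"
      using lnorm_scaleR[OF E dl] t by simp
    also have "\<dots> \<le> 1 * lnorm E 0 (x - y)"
      using t lnorm_nonneg[OF E dl] by (intro mult_right_mono) auto
    finally show "lnorm E 0 (x - (x + t *\<^sub>R (y - x))) < \<delta>" using y by simp
  qed
  then show ?thesis using \<open>\<delta> > 0\<close> by blast
qed

text \<open>
  For \<open>k\<close> in the cone \<open>C\<close>, the ray \<open>x + t k\<close> stays in \<open>U\<close> for small \<open>t > 0\<close>, so the limit determines
  the derivative on level-1 points of \<open>C\<close>; by linearity it does on \<open>E\<^sub>1\<close>, by density and boundedness on
  \<open>E\<^sub>0\<close>.
\<close>

lemma sc_derivative_unique:
  assumes E: "sc_banach E" and F: "normed_scale F" and C: "partial_quadrant E C"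
    and U: "openin (subtopology (level_top E 0) C) U" and f: "f ` U \<subseteq> level F 0"
    and x: "x \<in> U \<inter> level E 1"
    and L: "has_sc_derivative E U F f x L" and L': "has_sc_derivative E U F f x L'"
    and h: "h \<in> level E 0"
  shows "L h = L' h"
proof -
  note nE = sc_banach_normed_scale[OF E]
  note cone = partial_quadrant_cone[OF nE C]
  have xU: "x \<in> U" and xC: "x \<in> C" using x openin_subset[OF U] by auto
  have lin: "linear_between (level E 0) (level F 0) L"
    and bd: "\<exists>B. \<forall>h\<in>level E 0. lnorm F 0 (L h) \<le> B * lnorm E 0 h"
    and o: "\<And>\<epsilon>. \<epsilon> > 0 \<Longrightarrow> \<exists>\<delta>>0. \<forall>h \<in> level E 1. x + h \<in> U \<and> lnorm E 1 h < \<delta> \<longrightarrow>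
        lnorm F 0 (f (x + h) - f x - L h) \<le> \<epsilon> * lnorm E 1 h"
    using L unfolding has_sc_derivative_iff_little_o[OF nE F xU f] by blast+
  have lin': "linear_between (level E 0) (level F 0) L'"
    and bd': "\<exists>B. \<forall>h\<in>level E 0. lnorm F 0 (L' h) \<le> B * lnorm E 0 h"
    and o': "\<And>\<epsilon>. \<epsilon> > 0 \<Longrightarrow> \<exists>\<delta>>0. \<forall>h \<in> level E 1. x + h \<in> U \<and> lnorm E 1 h < \<delta> \<longrightarrow>
        lnorm F 0 (f (x + h) - f x - L' h) \<le> \<epsilon> * lnorm E 1 h"
    using L' unfolding has_sc_derivative_iff_little_o[OF nE F xU f] by blast+
  have lev: "L k \<in> level F 0" "L' k \<in> level F 0" if "k \<in> level E 0" for k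
    using linear_betweenD(1)[OF lin that] linear_betweenD(1)[OF lin' that] by auto
  have zero: "a = b" if ab: "a \<in> level F 0" "b \<in> level F 0" and "c \<ge> 0"
    and small: "\<And>\<epsilon>. \<epsilon> > 0 \<Longrightarrow> lnorm F 0 (a - b) \<le> \<epsilon> * c" for a b c
  proof -
    have "lnorm F 0 (a - b) \<le> 0"
    proof (rule field_le_epsilon)
      fix e :: real assume "e > 0"
      then have "lnorm F 0 (a - b) \<le> e / (c + 1) * c" using \<open>c \<ge> 0\<close> by (intro small) simp
      also have "\<dots> \<le> e" using \<open>e > 0\<close> \<open>c \<ge> 0\<close> by (simp add: field_simps)
      finally show "lnorm F 0 (a - b) \<le> 0 + e" by simp
    qed
    then show ?thesis
      using lnorm_nonneg[OF F level_closed(3)[OF F ab]] lnorm_eq_0[OF F level_closed(3)[OF F ab]] by simp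
  qed
  have on_C: "L k = L' k" if k: "k \<in> C" "k \<in> level E 1" for k
  proof (rule zero)
    have k0: "k \<in> level E 0" using k cone(1) by blast
    show "L k \<in> level F 0" "L' k \<in> level F 0" using lev[OF k0] by auto
    show "0 \<le> 2 * lnorm E 1 k" using lnorm_nonneg[OF nE k(2)] by simp
    fix \<epsilon> :: real assume "\<epsilon> > 0"
    obtain \<delta> where "\<delta> > 0" and d: "\<And>h. h \<in> level E 1 \<Longrightarrow> x + h \<in> U \<Longrightarrow> lnorm E 1 h < \<delta> \<Longrightarrow>
        lnorm F 0 (f (x + h) - f x - L h) \<le> \<epsilon> * lnorm E 1 h" using o[OF \<open>\<epsilon> > 0\<close>] by blast
    obtain \<delta>' where "\<delta>' > 0" and d': "\<And>h. h \<in> level E 1 \<Longrightarrow> x + h \<in> U \<Longrightarrow> lnorm E 1 h < \<delta>' \<Longrightarrow>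
        lnorm F 0 (f (x + h) - f x - L' h) \<le> \<epsilon> * lnorm E 1 h" using o'[OF \<open>\<epsilon> > 0\<close>] by blast
    obtain \<rho> where "\<rho> > 0" and r: "\<And>y. y \<in> C \<Longrightarrow> lnorm E 0 (x - y) < \<rho> \<Longrightarrow> y \<in> U"
      using openin_level_ball[OF nE cone(1) U xU] by blast
    \<comment> \<open>Small enough for both difference quotients and for \<open>x + t k\<close> to stay in \<open>U\<close>.\<close>
    define t where "t = min (min \<delta> \<delta>' / (lnorm E 1 k + 1)) (\<rho> / (lnorm E 0 k + 1))"
    have n: "lnorm E 1 k \<ge> 0" "lnorm E 0 k \<ge> 0" using lnorm_nonneg[OF nE] k(2) k0 by auto
    have "t > 0" using n \<open>\<delta> > 0\<close> \<open>\<delta>' > 0\<close> \<open>\<rho> > 0\<close> by (simp add: t_def)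
    have "t * (lnorm E 1 k + 1) \<le> min \<delta> \<delta>'" "t * (lnorm E 0 k + 1) \<le> \<rho>"
      using n unfolding t_def by (subst pos_le_divide_eq[symmetric]; simp)+
    then have t: "t * lnorm E 1 k < \<delta>" "t * lnorm E 1 k < \<delta>'" "t * lnorm E 0 k < \<rho>"
      using \<open>t > 0\<close> by (auto simp: distrib_left)
    have tk1: "t *\<^sub>R k \<in> level E 1" by (rule level_closed(4)[OF nE k(2)])
    have nk: "lnorm E 1 (t *\<^sub>R k) = t * lnorm E 1 k"
      using lnorm_scaleR[OF nE k(2)] \<open>t > 0\<close> by simp
    have "lnorm E 0 (x - (x + t *\<^sub>R k)) = t * lnorm E 0 k"
      using lnorm_scaleR[OF nE k0, of "- t"] \<open>t > 0\<close> by simp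
    then have xk: "x + t *\<^sub>R k \<in> U"
      using xC k \<open>t > 0\<close> t(3) by (intro r cone(2,3)) auto
    let ?\<Delta> = "f (x + t *\<^sub>R k) - f x"
    have \<Delta>: "?\<Delta> \<in> level F 0" using f xk xU level_closed(3)[OF F] by blast
    have s: "L (t *\<^sub>R k) = t *\<^sub>R L k" "L' (t *\<^sub>R k) = t *\<^sub>R L' k"
      using linear_betweenD(3)[OF lin k0] linear_betweenD(3)[OF lin' k0] by auto
    have "t *\<^sub>R (L k - L' k) = (?\<Delta> - L' (t *\<^sub>R k)) - (?\<Delta> - L (t *\<^sub>R k))"
      unfolding s by (simp add: algebra_simps)
    moreover have "lnorm F 0 (t *\<^sub>R (L k - L' k)) = t * lnorm F 0 (L k - L' k)"
      using lnorm_scaleR[OF F level_closed(3)[OF F lev[OF k0]]] \<open>t > 0\<close> by simp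
    ultimately have "t * lnorm F 0 (L k - L' k) = lnorm F 0 ((?\<Delta> - L' (t *\<^sub>R k)) - (?\<Delta> - L (t *\<^sub>R k)))"
      by simp
    also have "\<dots> \<le> lnorm F 0 (?\<Delta> - L' (t *\<^sub>R k)) + lnorm F 0 (?\<Delta> - L (t *\<^sub>R k))"
      by (rule lnorm_triangle_diff[OF F level_closed(3)[OF F \<Delta>] level_closed(3)[OF F \<Delta>]])
        (rule lev[OF level_closed(4)[OF nE k0]])+
    also have "\<dots> \<le> \<epsilon> * (t * lnorm E 1 k) + \<epsilon> * (t * lnorm E 1 k)"
      using d[OF tk1 xk] d'[OF tk1 xk] t unfolding nk by (intro add_mono) auto
    also have "\<dots> = t * (\<epsilon> * (2 * lnorm E 1 k))" by (simp add: algebra_simps)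
    finally show "lnorm F 0 (L k - L' k) \<le> \<epsilon> * (2 * lnorm E 1 k)"
      using \<open>t > 0\<close> by (simp only: mult_le_cancel_left_pos)
  qed
  have on_1: "L k = L' k" if k: "k \<in> level E 1" for k
  proof -
    obtain u where u: "u \<in> C" "u \<in> level E 1" "k + u \<in> C"
      using partial_quadrant_spans_level_1[OF nE C k] by blast
    have k0: "k \<in> level E 0" and u0: "u \<in> level E 0" using k u level_0[OF nE] by auto
    have "L (k + u) = L' (k + u)" "L u = L' u"
      using u level_closed(2)[OF nE k u(2)] by (auto intro: on_C)
    then show ?thesis
      using linear_betweenD(2)[OF lin k0 u0] linear_betweenD(2)[OF lin' k0 u0] by simp
  qed
  obtain B where "B > 0" and B: "\<forall>h\<in>level E 0. lnorm F 0 (L h) \<le> B * lnorm E 0 h"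
    using positive_bound[OF nE bd] by blast
  obtain B' where "B' > 0" and B': "\<forall>h\<in>level E 0. lnorm F 0 (L' h) \<le> B' * lnorm E 0 h"
    using positive_bound[OF nE bd'] by blast
  show ?thesis
  proof (rule zero)
    show "L h \<in> level F 0" "L' h \<in> level F 0" using lev[OF h] by auto
    show "0 \<le> B + B'" using \<open>B > 0\<close> \<open>B' > 0\<close> by simp
    fix \<epsilon> :: real assume "\<epsilon> > 0"
    then obtain k where k: "k \<in> level E 1" "lnorm E 0 (h - k) < \<epsilon>" using level_1_dense[OF E h] by blast
    have k0: "k \<in> level E 0" by (rule level_0[OF nE k(1)])
    have hk: "h - k \<in> level E 0" by (rule level_closed(3)[OF nE h k0])
    have "L h = L (h - k) + L k" "L' h = L' (h - k) + L' k"
      using linear_betweenD(2)[OF lin hk k0] linear_betweenD(2)[OF lin' hk k0] by auto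
    then have "L h - L' h = L (h - k) - L' (h - k)" using on_1[OF k(1)] by simp
    also have "lnorm F 0 \<dots> \<le> lnorm F 0 (L (h - k)) + lnorm F 0 (L' (h - k))"
      by (rule lnorm_triangle_diff[OF F lev[OF hk]])
    also have "\<dots> \<le> B * lnorm E 0 (h - k) + B' * lnorm E 0 (h - k)"
      using B B' hk by (intro add_mono) auto
    also have "\<dots> \<le> B * \<epsilon> + B' * \<epsilon>"
      using k(2) \<open>B > 0\<close> \<open>B' > 0\<close> by (intro add_mono mult_left_mono) auto
    finally show "lnorm F 0 (L h - L' h) \<le> \<epsilon> * (B + B')" by (simp add: algebra_simps)
  qed
qed

section \<open>Functoriality of the tangent map\<close>

lemma sc0_codomain:
  assumes E: "normed_scale E" and F: "normed_scale F"
    and f: "sc0 E U F V f" and V': "\<And>x. x \<in> U \<inter> level E 0 \<Longrightarrow> f x \<in> V'"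
  shows "sc0 E U F V' f"
  unfolding sc0_iff[OF E F]
proof (intro allI ballI)
  fix m x assume x: "x \<in> U \<inter> level E m"
  then have "f x \<in> V'" using level_0[OF E] by (intro V') blast
  then show "f x \<in> V' \<inter> level F m \<and> (\<forall>\<epsilon>>0. \<exists>\<delta>>0. \<forall>y \<in> U \<inter> level E m.
      lnorm E m (x - y) < \<delta> \<longrightarrow> lnorm F m (f x - f y) < \<epsilon>)"
    using f[unfolded sc0_iff[OF E F], rule_format, OF x] by simp
qed

lemma sc0_cong:
  assumes "normed_scale E" "normed_scale F" "\<And>x. x \<in> U \<Longrightarrow> f x = f' x"
  shows "sc0 E U F V f \<longleftrightarrow> sc0 E U F V f'"
  using assms(3) unfolding sc0_iff[OF assms(1,2)] by simp

lemma has_sc_derivative_cong: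
  assumes E: "normed_scale E" and x: "x \<in> U" and f: "\<And>x. x \<in> U \<Longrightarrow> f x = f' x"
  shows "has_sc_derivative E U F f x L \<longleftrightarrow> has_sc_derivative E U F f' x L"
  unfolding has_sc_derivative_iff[OF E] using f x by simp

lemma sc1I:
  assumes "sc0 E U F V f" "\<And>x. x \<in> U \<inter> level E 1 \<Longrightarrow> has_sc_derivative E U F f x (D x)"
    and "sc0 (T_space E) (T_set E U) (T_space F) (T_set F V) (T_with f D)"
  shows "sc1 E U F V f"
  unfolding sc1_def using assms by (intro conjI exI[of _ D] ballI)

lemma sc1_codomain:
  assumes E: "normed_scale E" and F: "normed_scale F"
    and f: "sc1 E U F V f" and V': "\<And>x. x \<in> U \<Longrightarrow> f x \<in> V'"
  shows "sc1 E U F V' f"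
proof -
  note nT = normed_scale_T_space[OF E] normed_scale_T_space[OF F]
  obtain D where f0: "sc0 E U F V f" and D: "\<forall>x \<in> U \<inter> level E 1. has_sc_derivative E U F f x (D x)"
    and T: "sc0 (T_space E) (T_set E U) (T_space F) (T_set F V) (T_with f D)"
    using f unfolding sc1_def by blast
  show ?thesis
  proof (rule sc1I)
    show "sc0 E U F V' f" using V' by (intro sc0_codomain[OF E F f0]) simp
    show "has_sc_derivative E U F f x (D x)" if "x \<in> U \<inter> level E 1" for x by (rule bspec[OF D that])
    show "sc0 (T_space E) (T_set E U) (T_space F) (T_set F V') (T_with f D)"
    proof (rule sc0_codomain[OF nT T])
      fix p assume p: "p \<in> T_set E U \<inter> level (T_space E) 0"
      then have "T_with f D p \<in> T_set F V" using T[unfolded sc0_iff[OF nT]] by blast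
      then show "T_with f D p \<in> T_set F V'" using p V' by (auto simp: T_set_def T_with_def)
    qed
  qed
qed

lemma sc1_cong:
  assumes E: "normed_scale E" and F: "normed_scale F" and eq: "\<And>x. x \<in> U \<Longrightarrow> f x = f' x"
    and f: "sc1 E U F V f"
  shows "sc1 E U F V f'"
proof -
  obtain D where f0: "sc0 E U F V f" and D: "\<forall>x \<in> U \<inter> level E 1. has_sc_derivative E U F f x (D x)"
    and T: "sc0 (T_space E) (T_set E U) (T_space F) (T_set F V) (T_with f D)"
    using f unfolding sc1_def by blast
  show ?thesis
  proof (rule sc1I)
    show "sc0 E U F V f'" by (rule iffD1[OF sc0_cong[OF E F eq] f0])
    show "has_sc_derivative E U F f' x (D x)" if "x \<in> U \<inter> level E 1" for x
      by (rule iffD1[OF has_sc_derivative_cong[OF E _ eq] bspec[OF D that]]) (use that in auto)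
    have "T_with f D p = T_with f' D p" if "p \<in> T_set E U" for p
      using that eq by (auto simp: T_set_def T_with_def)
    then show "sc0 (T_space E) (T_set E U) (T_space F) (T_set F V) (T_with f' D)"
      by (rule iffD1[OF sc0_cong[OF normed_scale_T_space[OF E] normed_scale_T_space[OF F]] T])
  qed
qed

lemma T_map_cong:
  assumes E: "normed_scale E" and eq: "\<And>x. x \<in> U \<Longrightarrow> f x = f' x" and p: "p \<in> T_set E U"
  shows "T_map E U F f p = T_map E U F f' p"
proof -
  obtain x h where xh: "p = (x, h)" "x \<in> U" using p by (auto simp: T_set_def)
  have "has_sc_derivative E U F f x = has_sc_derivative E U F f' x"
    by (rule ext) (rule has_sc_derivative_cong[OF E xh(2) eq])
  then show ?thesis using eq xh by (simp add: T_map_def T_with_def sc_D_def)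
qed

lemma relatively_open_subset_level:
  assumes "normed_scale E" "openin (subtopology (level_top E 0) C) U"
  shows "U \<subseteq> level E 0"
  using openin_subset[OF assms(2)] assms(1) by auto

text \<open>
  The tangent map is defined by a choice of derivative; uniqueness lets it be computed with any family
  of derivatives.
\<close>

lemma T_map_eq_T_with:
  assumes E: "sc_banach E" and F: "normed_scale F" and C: "partial_quadrant E C"
    and U: "openin (subtopology (level_top E 0) C) U" and f: "f ` U \<subseteq> level F 0"
    and D: "\<And>x. x \<in> U \<inter> level E 1 \<Longrightarrow> has_sc_derivative E U F f x (D x)"
    and p: "p \<in> T_set E U"
  shows "T_map E U F f p = T_with f D p"
proof -
  obtain x h where xh: "p = (x, h)" "x \<in> U \<inter> level E 1" "h \<in> level E 0"
    using p by (auto simp: T_set_def)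
  have "has_sc_derivative E U F f x (sc_D E U F f x)"
    unfolding sc_D_def
    by (rule someI[of "has_sc_derivative E U F f x", OF D[OF xh(2)]])
  then have "sc_D E U F f x h = D x h"
    using sc_derivative_unique[OF E F C U f xh(2) _ D[OF xh(2)] xh(3)] by blast
  then show ?thesis using xh by (simp add: T_map_def T_with_def)
qed

text \<open>
  Holds for the family of derivatives in the definition of \<open>sc\<^sup>1\<close>, whose tangent map is \<open>sc\<^sup>0\<close> and so
  preserves level 0; uniqueness transfers it to the chosen derivative.
\<close>

lemma T_map_in_T_set:
  assumes E: "sc_banach E" and F: "normed_scale F" and C: "partial_quadrant E C"
    and U: "openin (subtopology (level_top E 0) C) U" and V: "V \<subseteq> level F 0"
    and f: "sc1 E U F V f" and p: "p \<in> T_set E U"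
  shows "T_map E U F f p \<in> T_set F V"
proof -
  note nE = sc_banach_normed_scale[OF E]
  note U0 = relatively_open_subset_level[OF nE U]
  note nT = normed_scale_T_space[OF nE] normed_scale_T_space[OF F]
  obtain D where f0: "sc0 E U F V f" and D: "\<forall>x \<in> U \<inter> level E 1. has_sc_derivative E U F f x (D x)"
    and T: "sc0 (T_space E) (T_set E U) (T_space F) (T_set F V) (T_with f D)"
    using f unfolding sc1_def by blast
  have "T_map E U F f p = T_with f D p"
    using D by (intro T_map_eq_T_with[OF E F C U sc0_image[OF nE F U0 f0] _ p]) blast
  moreover have "p \<in> level (T_space E) 0" using p T_set_subset[OF nE] by blast
  then have "T_with f D p \<in> T_set F V" using T[unfolded sc0_iff[OF nT]] p by blast
  ultimately show ?thesis by simp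
qed

text \<open>
  The family \<open>K (f x) \<circ> D x\<close> is a derivative of \<open>g \<circ> f\<close> whose tangent map is the composite of two
  \<open>sc\<^sup>0\<close>-maps; by uniqueness it also computes the tangent map that is built from a chosen derivative.
\<close>

theorem sc_chain_rule:
  assumes E: "sc_banach E" and F: "sc_banach F" and G: "normed_scale G"
    and C: "partial_quadrant E C" and U: "openin (subtopology (level_top E 0) C) U"
    and C': "partial_quadrant F C'" and V: "openin (subtopology (level_top F 0) C') V"
    and W: "W \<subseteq> level G 0"
    and f: "sc1 E U F V f" and g: "sc1 F V G W g"
  shows "sc1 E U G W (g \<circ> f)"
    and "p \<in> T_set E U \<Longrightarrow> T_map E U G (g \<circ> f) p = T_map F V G g (T_map E U F f p)"
proof -
  note nE = sc_banach_normed_scale[OF E] and nF = sc_banach_normed_scale[OF F]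
  note U0 = relatively_open_subset_level[OF nE U] and V0 = relatively_open_subset_level[OF nF V]
  obtain D where f0: "sc0 E U F V f" and D: "\<And>x. x \<in> U \<inter> level E 1 \<Longrightarrow> has_sc_derivative E U F f x (D x)"
    and Tf: "sc0 (T_space E) (T_set E U) (T_space F) (T_set F V) (T_with f D)"
    using f unfolding sc1_def by blast
  obtain K where g0: "sc0 F V G W g" and K: "\<And>x. x \<in> V \<inter> level F 1 \<Longrightarrow> has_sc_derivative F V G g x (K x)"
    and Tg: "sc0 (T_space F) (T_set F V) (T_space G) (T_set G W) (T_with g K)"
    using g unfolding sc1_def by blast
  let ?D = "\<lambda>x. K (f x) \<circ> D x"
  have gf0: "sc0 E U G W (g \<circ> f)"
    using f0 g0 unfolding sc0_def by (blast intro: continuous_map_compose)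
  have D': "has_sc_derivative E U G (g \<circ> f) x (?D x)" if "x \<in> U \<inter> level E 1" for x
    by (rule chain_rule_derivative[OF E nF G U0 V0 relatively_open_locally_convex[OF nF C' V]
          f0 that D[OF that] g0 K Tg])
  have TT: "T_with (g \<circ> f) ?D = T_with g K \<circ> T_with f D"
    by (auto simp: T_with_def)
  have Tgf: "sc0 (T_space E) (T_set E U) (T_space G) (T_set G W) (T_with (g \<circ> f) ?D)"
    using Tf Tg unfolding TT sc0_def by (blast intro: continuous_map_compose)
  show "sc1 E U G W (g \<circ> f)" by (rule sc1I[OF gf0 D' Tgf])
  note gf = sc0_image[OF nE G U0 gf0]
  assume p: "p \<in> T_set E U"
  have 1: "T_map E U F f p = T_with f D p"
    by (rule T_map_eq_T_with[OF E nF C U sc0_image[OF nE nF U0 f0] D p])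
  have q: "T_with f D p \<in> T_set F V"
    using T_map_in_T_set[OF E nF C U V0 f p] 1 by simp
  have "T_map F V G g (T_with f D p) = T_with g K (T_with f D p)"
    by (rule T_map_eq_T_with[OF F G C' V sc0_image[OF nF G V0 g0] K q])
  moreover have "T_map E U G (g \<circ> f) p = T_with (g \<circ> f) ?D p"
    by (rule T_map_eq_T_with[OF E G C U gf D' p])
  ultimately show "T_map E U G (g \<circ> f) p = T_map F V G g (T_map E U F f p)"
    using 1 TT by simp
qed

section \<open>Maps between local M-polyfold models\<close>

lemma sc_retraction_sc1:
  assumes E: "sc_banach E" and r: "sc_retraction E C U r"
  shows "sc1 E U E U r" "openin (subtopology (level_top E 0) C) U" "U \<subseteq> level E 0"
    "r ` U \<subseteq> U" "x \<in> r ` U \<Longrightarrow> r x = x"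
proof -
  note n = sc_banach_normed_scale[OF E]
  show U: "openin (subtopology (level_top E 0) C) U" using r by (simp add: sc_retraction_def)
  show U0: "U \<subseteq> level E 0" by (rule relatively_open_subset_level[OF n U])
  have "sc_k 1 E U E U r" using r by (simp add: sc_retraction_def sc_smooth_def)
  then show "sc1 E U E U r" using sc_k_1[OF n n U0 U0] by blast
  then have "sc0 E U E U r" by (simp add: sc1_def)
  then show "r ` U \<subseteq> U" using U0 unfolding sc0_iff[OF n n] by blast
  show "r x = x" if "x \<in> r ` U" using that r by (auto simp: sc_retraction_def)
qed

lemma retraction_onto_model:
  assumes "polyfold_model X C E"
  shows "\<exists>U r. retraction_onto X C E = (U, r) \<and> sc_retraction E C U r \<and> r ` U = X"
proof -
  have "\<exists>p. case p of (U, r) \<Rightarrow> sc_retraction E C U r \<and> r ` U = X"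
    using assms by (auto simp: polyfold_model_def)
  then have "case retraction_onto X C E of (U, r) \<Rightarrow> sc_retraction E C U r \<and> r ` U = X"
    unfolding retraction_onto_def by (rule someI_ex)
  then show ?thesis by (cases "retraction_onto X C E") auto
qed

text \<open>
  If \<open>r\<close> and \<open>s\<close> are retractions onto the same set, then \<open>r \<circ> s = s\<close> and hence \<open>f \<circ> s = (f \<circ> r) \<circ> s\<close>.
  This passes from the retraction witnessing that \<open>f\<close> is \<open>sc\<^sup>1\<close> to the chosen one that defines the
  tangent.
\<close>

lemma sc1_change_retraction:
  assumes E: "sc_banach E" and F: "normed_scale F" and C: "partial_quadrant E C" and W: "W \<subseteq> level F 0"
    and r: "sc_retraction E C U r" "r ` U = X" and s: "sc_retraction E C V s" "s ` V = X"
    and f: "sc1 E U F W (f \<circ> r)"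
  shows "sc1 E V F W (f \<circ> s)"
proof -
  note n = sc_banach_normed_scale[OF E]
  note R = sc_retraction_sc1[OF E r(1)] and S = sc_retraction_sc1[OF E s(1)]
  have "sc1 E V E U s"
    using r s R(4) by (intro sc1_codomain[OF n n S(1)]) auto
  then have "sc1 E V F W (f \<circ> r \<circ> s)"
    by (rule sc_chain_rule(1)[OF E E F C S(2) C R(2) W _ f])
  moreover have "(f \<circ> r \<circ> s) x = (f \<circ> s) x" if "x \<in> V" for x
  proof -
    have "s x \<in> r ` U" using that r(2) s(2) by blast
    then have "r (s x) = s x" by (rule R(5))
    then show ?thesis by simp
  qed
  ultimately show ?thesis by (rule sc1_cong[OF n F, rotated])
qed

theorem theorem1p17:
  fixes E :: "'a::real_vector sc_space" and X C :: "'a set"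
    and E' :: "'b::real_vector sc_space" and X' C' :: "'b set"
    and E'' :: "'c::real_vector sc_space" and X'' C'' :: "'c set"
    and f :: "'a \<Rightarrow> 'b" and g :: "'b \<Rightarrow> 'c"
  assumes "polyfold_model X C E" and "polyfold_model X' C' E'" and "polyfold_model X'' C'' E''"
    and "model_sc1 X C E X' C' E' f" and "model_sc1 X' C' E' X'' C'' E'' g"
  shows "model_sc1 X C E X'' C'' E'' (g \<circ> f) \<and>
    model_T_map X C E E'' (g \<circ> f) =
      compose (model_T X C E) (model_T_map X' C' E' E'' g) (model_T_map X C E E' f)"
proof -
  have E: "sc_banach E" and E': "sc_banach E'" and C: "partial_quadrant E C" and C': "partial_quadrant E' C'"
    and E'': "normed_scale E''"
    using assms(1-3) sc_banach_normed_scale by (auto simp: polyfold_model_def)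
  note nE = sc_banach_normed_scale[OF E] and nE' = sc_banach_normed_scale[OF E']
  obtain U r where r: "retraction_onto X C E = (U, r)" "sc_retraction E C U r" "r ` U = X"
    using retraction_onto_model[OF assms(1)] by blast
  obtain V s where s: "retraction_onto X' C' E' = (V, s)" "sc_retraction E' C' V s" "s ` V = X'"
    using retraction_onto_model[OF assms(2)] by blast
  note R = sc_retraction_sc1[OF E r(2)] and S = sc_retraction_sc1[OF E' s(2)]
  have fX: "f ` X \<subseteq> X'" and gX: "g ` X' \<subseteq> X''"
    using assms(4,5) by (auto simp: model_sc1_def)
  have "sc1 E U E' (level E' 0) (f \<circ> r)"
    using assms(4) sc1_change_retraction[OF E nE' C order_refl _ _ r(2,3)] unfolding model_sc1_def by blast
  moreover have "(f \<circ> r) x \<in> V" if "x \<in> U" for x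
    using that fX r(3) s(3) S(4) by auto
  ultimately have f1: "sc1 E U E' V (f \<circ> r)" using sc1_codomain[OF nE nE'] by blast
  have g1: "sc1 E' V E'' (level E'' 0) (g \<circ> s)"
    using assms(5) sc1_change_retraction[OF E' E'' C' order_refl _ _ s(2,3)] unfolding model_sc1_def by blast
  \<comment> \<open>\<open>f \<circ> r\<close> takes values in \<open>X'\<close>, the fixed point set of \<open>s\<close>.\<close>
  have sf: "s (f (r x)) = f (r x)" if "x \<in> U" for x
  proof (rule S(5))
    show "f (r x) \<in> s ` V" using that fX r(3) s(3) by blast
  qed
  have gf: "((g \<circ> s) \<circ> (f \<circ> r)) x = (g \<circ> f \<circ> r) x" if "x \<in> U" for x
    using sf[OF that] by simp
  note chain = sc_chain_rule[OF E E' E'' C R(2) C' S(2) order_refl f1 g1]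
  have "sc1 E U E'' (level E'' 0) (g \<circ> f \<circ> r)"
    by (rule sc1_cong[OF nE E'' gf chain(1)])
  then have 1: "model_sc1 X C E X'' C'' E'' (g \<circ> f)"
    unfolding model_sc1_def using r(2,3) fX gX by (intro conjI exI[of _ U] exI[of _ r]) auto
  have TX: "model_T X C E = T_map E U E r ` T_set E U"
    and TX': "model_T X' C' E' = T_map E' V E' s ` T_set E' V"
    using r s by (simp_all add: model_T_def)
  have "model_T_map X C E E'' (g \<circ> f) p =
      compose (model_T X C E) (model_T_map X' C' E' E'' g) (model_T_map X C E E' f) p" for p
  proof (cases "p \<in> model_T X C E")
    case False
    then show ?thesis using r by (simp add: model_T_map_def compose_def)
  next
    case True
    then have p: "p \<in> T_set E U"
      using T_map_in_T_set[OF E nE C R(2,3) R(1)] by (auto simp: TX)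
    let ?q = "T_map E U E' (f \<circ> r) p"
    have q: "?q \<in> T_set E' V" by (rule T_map_in_T_set[OF E nE' C R(2) S(3) f1 p])
    \<comment> \<open>The outer map is restricted to \<open>TX'\<close>, so \<open>?q \<in> TX'\<close> is needed before composing.\<close>
    have "T_map E U E' (s \<circ> (f \<circ> r)) p = T_map E' V E' s ?q"
      by (rule sc_chain_rule(2)[OF E E' nE' C R(2) C' S(2) S(3) f1 S(1) p])
    moreover have "T_map E U E' (s \<circ> (f \<circ> r)) p = ?q"
      using sf by (intro T_map_cong[OF nE _ p]) simp
    ultimately have "?q \<in> model_T X' C' E'" using q unfolding TX' by (metis imageI)
    then have "compose (model_T X C E) (model_T_map X' C' E' E'' g) (model_T_map X C E E' f) p
        = T_map E' V E'' (g \<circ> s) ?q"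
      using r s True by (simp add: model_T_map_def compose_def)
    also have "\<dots> = T_map E U E'' ((g \<circ> s) \<circ> (f \<circ> r)) p" by (rule chain(2)[OF p, symmetric])
    also have "\<dots> = T_map E U E'' (g \<circ> f \<circ> r) p" by (rule T_map_cong[OF nE gf p])
    also have "\<dots> = model_T_map X C E E'' (g \<circ> f) p"
      using r True by (simp add: model_T_map_def)
    finally show ?thesis by simp
  qed
  then show ?thesis using 1 by (simp add: fun_eq_iff)
qed

end
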